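(* There exists an absolute constant $C>0$ such that $$\inf_{\mu}\Big(\inf\Big\{\mathbb{E}_{\mu^N}\big[\mu(K_N)\big]: N\ge \exp(Cn\ln n)\Big\}\Big)\longrightarrow 1$$ as $n\to\infty$, where the first infimum is over all log-concave probability measures $\mu$ on $\mathbb{R}^n$ and the second one is over integers $N>n$ with $N\ge\exp(Cn\ln n)$.
   Context: A Borel probability measure $\mu$ on $\mathbb{R}^n$ is called log-concave if $\mu(H)<1$ for every hyperplane $H$ of $\mathbb{R}^n$ and $\mu(\lambda A+(1-\lambda)B)\ge \mu(A)^{\lambda}\mu(B)^{1-\lambda}$ for all compact sets $A,B\subset\mathbb{R}^n$ and all $\lambda\in(0,1)$. For an integer $N>n$, $K_N=\mathrm{conv}\{X_1,\ldots,X_N\}$ where $X_1,\ldots,X_N$ are independent random vectors in $\mathbb{R}^n$ each distributed according to $\mu$; $\mu^N$ is the product measure $\mu\times\cdots\times\mu$ ($N$ times) and $\mathbb{E}_{\mu^N}$ is the expectation with respect to it. *)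

theory Defs
  imports "HOL-Probability.Probability"
begin

text \<open>
  The dimension \<open>n\<close> varies inside the statement, so \<open>\<real>\<^sup>n\<close> is the set
  \<open>{..<n} \<rightarrow>\<^sub>E UNIV\<close> of extensional real functions on \<open>{..<n}\<close>. This is the carrier
  of both \<open>product_topology (\<lambda>_. euclideanreal) {..<n}\<close> and \<open>Pi\<^sub>M {..<n} (\<lambda>_. borel)\<close>.
\<close>

definition Rn :: "nat \<Rightarrow> (nat \<Rightarrow> real) set" where
  "Rn n = {..<n} \<rightarrow>\<^sub>E UNIV"

definition Rn_topology :: "nat \<Rightarrow> (nat \<Rightarrow> real) topology" where
  "Rn_topology n = product_topology (\<lambda>_. euclideanreal) {..<n}"

definition Rn_borel :: "nat \<Rightarrow> (nat \<Rightarrow> real) measure" where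
  "Rn_borel n = sigma (Rn n) {U. openin (Rn_topology n) U}"

text \<open>Only the \<open>\<sigma>\<close>-algebra of \<open>Rn_borel n\<close> is used; as a measure it is zero.\<close>

definition Rn_lincomb :: "nat \<Rightarrow> real \<Rightarrow> (nat \<Rightarrow> real) \<Rightarrow> real \<Rightarrow> (nat \<Rightarrow> real) \<Rightarrow> (nat \<Rightarrow> real)" where
  "Rn_lincomb n u x v y = (\<lambda>i\<in>{..<n}. u * x i + v * y i)"

definition Rn_convex :: "nat \<Rightarrow> (nat \<Rightarrow> real) set \<Rightarrow> bool" where
  "Rn_convex n S \<longleftrightarrow> S \<subseteq> Rn n \<and>
     (\<forall>x\<in>S. \<forall>y\<in>S. \<forall>u\<ge>0. \<forall>v\<ge>0. u + v = 1 \<longrightarrow> Rn_lincomb n u x v y \<in> S)"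

definition Rn_hyperplane :: "nat \<Rightarrow> (nat \<Rightarrow> real) set \<Rightarrow> bool" where
  "Rn_hyperplane n H \<longleftrightarrow>
     (\<exists>a b. (\<exists>i<n. a i \<noteq> 0) \<and> H = {x \<in> Rn n. (\<Sum>i<n. a i * x i) = b})"

definition log_concave_prob :: "nat \<Rightarrow> (nat \<Rightarrow> real) measure \<Rightarrow> bool" where
  "log_concave_prob n \<mu> \<longleftrightarrow>
     prob_space \<mu> \<and> sets \<mu> = sets (Rn_borel n) \<and>
     (\<forall>H. Rn_hyperplane n H \<longrightarrow> measure \<mu> H < 1) \<and>
     (\<forall>A B l. compactin (Rn_topology n) A \<longrightarrow> compactin (Rn_topology n) B \<longrightarrow> 0 < l \<longrightarrow> l < 1 \<longrightarrow>
        measure \<mu> {Rn_lincomb n l x (1 - l) y |x y. x \<in> A \<and> y \<in> B}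
          \<ge> measure \<mu> A powr l * measure \<mu> B powr (1 - l))"

text \<open>The convex hull of a set is, as in the library, the intersection of all convex supersets.\<close>

definition random_polytope :: "nat \<Rightarrow> nat \<Rightarrow> (nat \<Rightarrow> nat \<Rightarrow> real) \<Rightarrow> (nat \<Rightarrow> real) set" where
  "random_polytope n N X = Rn_convex n hull (X ` {..<N})"

definition expected_polytope_measure :: "nat \<Rightarrow> nat \<Rightarrow> (nat \<Rightarrow> real) measure \<Rightarrow> real" where
  "expected_polytope_measure n N \<mu> =
     (\<integral>X. measure \<mu> (random_polytope n N X) \<partial>(Pi\<^sub>M {..<N} (\<lambda>_. \<mu>)))"

lemma topspace_Rn_topology: "topspace (Rn_topology n) = Rn n"
  by (simp add: Rn_topology_def Rn_def)

lemma space_Rn_borel: "space (Rn_borel n) = Rn n"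
proof -
  have "{U. openin (Rn_topology n) U} \<subseteq> Pow (Rn n)"
    using openin_subset[of "Rn_topology n"] unfolding topspace_Rn_topology by blast
  then show ?thesis by (simp add: Rn_borel_def space_measure_of)
qed

lemma sets_Rn_borel: "sets (Rn_borel n) = sets (Pi\<^sub>M {..<n} (\<lambda>_. borel))"
proof -
  have sub: "{U. openin (Rn_topology n) U} \<subseteq> Pow (Rn n)"
    using openin_subset[of "Rn_topology n"] unfolding topspace_Rn_topology by blast
  then have eq: "sets (Rn_borel n) = sigma_sets (Rn n) {U. openin (Rn_topology n) U}"
    by (simp add: Rn_borel_def sets_measure_of)
  obtain B :: "real set set" where B: "countable B" "topological_basis B"
    using ex_countable_basis by auto
  have "U \<in> sets (Pi\<^sub>M {..<n} (\<lambda>_. borel))" if U: "openin (Rn_topology n) U" for U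
  proof -
    define F where "F = {f \<in> {..<n} \<rightarrow>\<^sub>E B. Pi\<^sub>E {..<n} f \<subseteq> U}"
    have "countable ({..<n} \<rightarrow>\<^sub>E B)"
      by (intro countable_PiE) (use B in auto)
    then have cF: "countable F" by (rule countable_subset[rotated]) (auto simp: F_def)
    have "U \<subseteq> (\<Union>f\<in>F. Pi\<^sub>E {..<n} f)"
    proof
      fix x assume x: "x \<in> U"
      have "\<exists>V. finite {i \<in> {..<n}. V i \<noteq> topspace euclideanreal} \<and>
          (\<forall>i\<in>{..<n}. openin euclideanreal (V i)) \<and> x \<in> Pi\<^sub>E {..<n} V \<and> Pi\<^sub>E {..<n} V \<subseteq> U"
        using U x unfolding Rn_topology_def openin_product_topology_alt by (rule bspec)
      then obtain V where V0: "\<forall>i\<in>{..<n}. openin euclideanreal (V i)"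
          and V: "x \<in> Pi\<^sub>E {..<n} V" "Pi\<^sub>E {..<n} V \<subseteq> U"
        by (elim exE conjE)
      have "\<exists>b\<in>B. x i \<in> b \<and> b \<subseteq> V i" if "i < n" for i
      proof -
        have "open (V i)" "x i \<in> V i"
          using V0 V(1) that by (simp_all add: PiE_iff)
        then show ?thesis using topological_basisE[OF B(2)] by metis
      qed
      then obtain g where g: "\<And>i. i < n \<Longrightarrow> g i \<in> B \<and> x i \<in> g i \<and> g i \<subseteq> V i" by metis
      have "Pi\<^sub>E {..<n} (restrict g {..<n}) \<subseteq> Pi\<^sub>E {..<n} V"
        using g by (intro PiE_mono) simp
      then have "restrict g {..<n} \<in> F"
        using g V(2) unfolding F_def by auto
      moreover have "x \<in> Pi\<^sub>E {..<n} (restrict g {..<n})"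
        using g V(1) by (auto simp: PiE_iff)
      ultimately show "x \<in> (\<Union>f\<in>F. Pi\<^sub>E {..<n} f)" by blast
    qed
    then have "U = (\<Union>f\<in>F. Pi\<^sub>E {..<n} f)" by (auto simp: F_def)
    moreover have "Pi\<^sub>E {..<n} f \<in> sets (Pi\<^sub>M {..<n} (\<lambda>_. borel))" if "f \<in> F" for f
      using that B(2) by (intro sets_PiM_I_finite) (auto simp: F_def PiE_iff intro: borel_open topological_basis_open)
    ultimately show ?thesis using sets.countable_UN'[OF cF, of "Pi\<^sub>E {..<n}"] by (simp add: image_subset_iff)
  qed
  then have "sets (Rn_borel n) \<subseteq> sets (Pi\<^sub>M {..<n} (\<lambda>_. borel))"
    using sets.sigma_sets_subset[of "{U. openin (Rn_topology n) U}" "Pi\<^sub>M {..<n} (\<lambda>_. borel)"]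
    unfolding eq Rn_def by (auto simp: space_PiM)
  moreover have "sets (Pi\<^sub>M {..<n} (\<lambda>_. borel)) \<subseteq> sets (Rn_borel n)"
  proof -
    have comp: "(\<lambda>x. x i) \<in> borel_measurable (Rn_borel n)" if "i < n" for i
    proof (rule borel_measurableI)
      fix S :: "real set" assume "open S"
      have "continuous_map (Rn_topology n) euclideanreal (\<lambda>x. x i)"
        unfolding Rn_topology_def using that by (intro continuous_map_product_projection) auto
      then have "openin (Rn_topology n) {x \<in> topspace (Rn_topology n). x i \<in> S}"
        using \<open>open S\<close> by (auto simp: continuous_map_def)
      moreover have "{x \<in> topspace (Rn_topology n). x i \<in> S} = (\<lambda>x. x i) -` S \<inter> space (Rn_borel n)"
        by (auto simp: space_Rn_borel Rn_def Rn_topology_def)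
      ultimately show "(\<lambda>x. x i) -` S \<inter> space (Rn_borel n) \<in> sets (Rn_borel n)"
        unfolding eq by (auto intro: sigma_sets.Basic)
    qed
    have "{f \<in> Rn n. f i \<in> A} \<in> sets (Rn_borel n)" if "i < n" "A \<in> sets borel" for i A
      using measurable_sets[OF comp[OF that(1)] that(2)]
      by (simp add: space_Rn_borel vimage_def Int_def conj_commute)
    then have "{{f \<in> Rn n. f i \<in> A} |i A. i \<in> {..<n} \<and> A \<in> sets borel} \<subseteq> sets (Rn_borel n)"
      by auto
    from sets.sigma_sets_subset[OF this] show ?thesis
      unfolding sets_PiM_single space_Rn_borel by (simp add: Rn_def)
  qed
  ultimately show ?thesis by blast
qed

end

theory Submission
  imports Defs "HOL-Real_Asymp.Real_Asymp"
begin

text \<open>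
  An affine image of \<open>\<mu>\<close> is isotropic; it is again log-concave, and no density is needed.
  Cut the box \<open>[-n,n]\<^sup>n\<close>, which carries almost all the mass, into \<open>n\<^bsup>O(n)\<^esup>\<close> small cubes \<open>f + Q\<close>,
  and discard those of mass below \<open>\<delta> = n\<^bsup>-O(n)\<^esup>\<close>; this loses only mass \<open>1/n\<close>. The set \<open>W\<close> of all \<open>w\<close> with
  \<open>\<mu>(w + Q) \<ge> \<delta>\<close> is convex by log-concavity, and it contains a neighbourhood of the origin of size
  \<open>1/n\<close> because every unit direction has mass bounded below beyond a fixed distance from the mean.
  Contracting the remaining cubes by \<open>1 - 1/n\<^sup>2\<close> towards the origin costs a factor of at most \<open>\<delta>\<^bsup>1/n\<^sup>2\<^esup> \<longlonglongrightarrow> 1\<close>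
  in mass, and around each point \<open>x\<close> of the contracted set there are \<open>2n\<close> cubes of mass at least \<open>\<delta>\<close>
  such that \<open>x\<close> lies in the convex hull of any choice of one point from each. Hence
  \<open>P(x \<notin> K\<^sub>N) \<le> 2n(1-\<delta>)\<^sup>N\<close>, which tends to 0 if \<open>N \<ge> n\<^bsup>10n\<^esup>\<close>.

  The infimum of the empty set of reals is unspecified, so a log-concave measure has to be exhibited in
  every dimension: the uniform measure on the cube, by the Prekopa-Leindler inequality.
\<close>

section \<open>Convex hulls and separation\<close>

text \<open>The obstacle is the boundary of \<open>W\<close>: a massive cube there need not have
  massive cubes on all sides. If \<open>f\<close> lies in \<open>W\<close> and all coordinates of
  \<open>c\<close> are at most \<open>\<rho> = 1/(200 n)\<close> in absolute value, convexity puts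
  \<open>(1-t) f + t c\<close> in \<open>W\<close>, so a contraction by \<open>1-t\<close> buys room
  \<open>t \<rho>\<close> in every direction. The cubes have to be finer than this room: cubes
  displaced by \<open>t \<rho>\<close> along the axes enclose the points of the undisplaced one if
  \<open>n s \<le> t \<rho>\<close>, and \<open>t = 1/n^2\<close> then gives the side
  \<open>s = 1/(200 n^4)\<close>. With this side, ln(1/\<delta>) is at most 7 n ln n for large n, so
  \<open>t\<close> has to be o(1/(n ln n)) for the mass factor to tend to 1, and
  \<open>1/n^2\<close> suffices. For \<open>N \<ge> n^(10 n)\<close> the product \<delta> N is at
  least \<open>n^(3 n)\<close>, far more than the union bound over 2n cubes requires.

  All convexity is reduced to one finite-dimensional alternative: either a convex combination of
  finitely many vectors vanishes, or one functional is positive on all of them. It describes the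
  random polytope, makes it jointly measurable, shows that central cubes are massive, and carries
  covers back from isotropic position.\<close>

lemma compact_simplex:
  fixes J :: "'j set"
  assumes J: "finite J"
  shows "compact {w :: 'j \<Rightarrow> real. (\<forall>j. 0 \<le> w j) \<and> (\<forall>j. j \<notin> J \<longrightarrow> w j = 0) \<and> sum w J = 1}"
    (is "compact ?S")
proof -
  \<comment> \<open>Coordinates outside \<open>J\<close> are pinned to 0, so that Tychonoff applies
    over the whole index type.\<close>
  let ?P = "PiE UNIV (\<lambda>j. if j \<in> J then {0..1::real} else {0})"
  have "compactin (product_topology (\<lambda>_. euclidean) UNIV) ?P"
    by (subst compactin_PiE) auto
  then have P: "compact ?P"
    by (simp add: euclidean_product_topology)
  have cont: "continuous_on UNIV (\<lambda>w :: 'j \<Rightarrow> real. w j)" for j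
    by simp
  have cl: "closed {w :: 'j \<Rightarrow> real. sum w J = 1}"
    by (intro closed_Collect_eq continuous_intros cont)
  have eq: "?S = ?P \<inter> {w. sum w J = 1}"
  proof (intro equalityI subsetI)
    fix w assume w: "w \<in> ?S"
    have "w j \<le> 1" if "j \<in> J" for j
    proof -
      have "w j \<le> sum w J" using w J that by (intro member_le_sum) auto
      then show ?thesis using w by simp
    qed
    then show "w \<in> ?P \<inter> {w. sum w J = 1}" using w by auto
  next
    fix w assume w: "w \<in> ?P \<inter> {w. sum w J = 1}"
    have "w j \<in> (if j \<in> J then {0..1} else {0})" for j
      using w by (simp add: PiE_iff)
    then have "0 \<le> w j \<and> (j \<notin> J \<longrightarrow> w j = 0)" for j
      by (metis atLeastAtMost_iff singletonD order_refl)
    then show "w \<in> ?S" using w by auto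
  qed
  show ?thesis
    unfolding eq by (rule compact_Int_closed[OF P cl])
qed

text \<open>The separating functional is the point of least Euclidean norm in the convex hull.\<close>

lemma gordan_alternative:
  fixes v :: "'j \<Rightarrow> nat \<Rightarrow> real"
  assumes J: "finite J" "J \<noteq> {}"
  shows "(\<exists>w. (\<forall>j. 0 \<le> w j) \<and> sum w J = 1 \<and> (\<forall>i<n. (\<Sum>j\<in>J. w j * v j i) = 0)) \<or>
         (\<exists>\<theta>. \<forall>j\<in>J. 0 < (\<Sum>i<n. \<theta> i * v j i))"
proof -
  define S where "S = {w :: 'j \<Rightarrow> real. (\<forall>j. 0 \<le> w j) \<and> (\<forall>j. j \<notin> J \<longrightarrow> w j = 0) \<and> sum w J = 1}"
  define u where "u = (\<lambda>(w :: 'j \<Rightarrow> real) i. \<Sum>j\<in>J. w j * v j i)"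
  define F where "F = (\<lambda>w. \<Sum>i<n. (u w i)\<^sup>2)"
  obtain j0 where j0: "j0 \<in> J" using J by auto
  have sumd: "(\<Sum>j\<in>J. (if j = k then 1 else 0) * f j) = (f k :: real)" if "k \<in> J" for k f
  proof -
    have "(\<Sum>j\<in>J. (if j = k then 1 else 0) * f j) = (\<Sum>j\<in>J. if j = k then f k else 0)"
      by (intro sum.cong) auto
    then show ?thesis using J that by simp
  qed
  have "(\<lambda>j. if j = j0 then 1 else 0) \<in> S"
    using j0 J by (auto simp: S_def)
  then have "S \<noteq> {}" by auto
  have cont: "continuous_on S (\<lambda>w :: 'j \<Rightarrow> real. w j)" for j
    by (rule continuous_on_subset[OF continuous_on_product_coordinates]) auto
  have "continuous_on S F"
    unfolding F_def u_def by (intro continuous_intros cont)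
  moreover have "compact S" unfolding S_def by (rule compact_simplex[OF J(1)])
  ultimately obtain w where w: "w \<in> S" and min: "\<And>z. z \<in> S \<Longrightarrow> F w \<le> F z"
    using continuous_attains_inf[of S F] \<open>S \<noteq> {}\<close> by auto
  show ?thesis
  proof (cases "F w = 0")
    case True
    then have "\<forall>i<n. u w i = 0"
      unfolding F_def by (subst (asm) sum_nonneg_eq_0_iff) auto
    then show ?thesis using w unfolding S_def u_def by blast
  next
    case False
    have "F w \<ge> 0" unfolding F_def by (intro sum_nonneg) auto
    with False have pos: "F w > 0" by simp
    have "0 < (\<Sum>i<n. u w i * v k i)" if k: "k \<in> J" for k
    proof -
      define L where "L = (\<Sum>i<n. u w i * v k i)"
      define D where "D = (\<Sum>i<n. (v k i - u w i)\<^sup>2)"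
      have D: "D \<ge> 0" unfolding D_def by (intro sum_nonneg) auto
      have ineq: "0 \<le> 2 * (L - F w) + t * D" if t: "0 < t" "t \<le> 1" for t
      proof -
        \<comment> \<open>First-order optimality: \<open>z\<close> moves from \<open>w\<close> a
          fraction \<open>t\<close> towards the vertex \<open>k\<close>. Minimality makes the change
          of \<open>F\<close> nonnegative, and dividing by \<open>t\<close> gives the
          inequality.\<close>
        define z where "z = (\<lambda>j. (1 - t) * w j + t * (if j = k then 1 else 0))"
        have "z \<in> S"
        proof -
          have "sum z J = (1 - t) * sum w J + t * (\<Sum>j\<in>J. (if j = k then 1 else 0))"
            unfolding z_def by (simp add: sum.distrib sum_distrib_left)
          also have "\<dots> = 1" using w k J by (simp add: S_def)
          finally show ?thesis using w t k unfolding S_def by (auto simp: z_def)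
        qed
        have uz: "u z i = u w i + t * (v k i - u w i)" for i
        proof -
          have "u z i = (1 - t) * u w i + t * (\<Sum>j\<in>J. (if j = k then 1 else 0) * v j i)"
            unfolding u_def z_def by (simp add: sum.distrib sum_distrib_left algebra_simps sum_subtractf)
          then show ?thesis using sumd[OF k] by (simp add: algebra_simps)
        qed
        have "F z = F w + t * (2 * (L - F w) + t * D)"
          unfolding F_def uz L_def D_def
          by (simp add: power2_eq_square sum.distrib sum_distrib_left sum_subtractf algebra_simps)
        with min[OF \<open>z \<in> S\<close>] have "0 \<le> t * (2 * (L - F w) + t * D)" by simp
        then show ?thesis using t by (simp add: zero_le_mult_iff)
      qed
      have "L \<ge> F w"
      proof (rule ccontr)
        assume "\<not> L \<ge> F w"
        then have neg: "L - F w < 0" by simp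
        \<comment> \<open>This step is so short that the quadratic term \<open>t * D\<close> is at
          most half of the linear gain \<open>2 * (F w - L)\<close>; the \<open>+ 1\<close> covers
          \<open>D = 0\<close>.\<close>
        define t where "t = min 1 ((F w - L) / (D + 1))"
        have "0 < t" "t \<le> 1" using neg D by (auto simp: t_def)
        moreover have "t * D \<le> F w - L"
        proof -
          have "t * D \<le> t * (D + 1)" using \<open>0 < t\<close> by (simp add: algebra_simps)
          also have "\<dots> \<le> (F w - L) / (D + 1) * (D + 1)"
            using D by (intro mult_right_mono) (auto simp: t_def)
          finally show ?thesis using D by simp
        qed
        ultimately have "0 \<le> 2 * (L - F w) + (F w - L)"
          using ineq[of t] by (meson add_left_mono order_trans)
        then show False using neg by (simp add: algebra_simps)
      qed
      then show ?thesis using pos unfolding L_def by linarith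
    qed
    then show ?thesis by blast
  qed
qed

lemma Rn_lincomb_in_Rn: "Rn_lincomb n u x v y \<in> Rn n"
  by (simp add: Rn_lincomb_def Rn_def)

lemma Rn_convex_sum:
  assumes "finite J" and C: "Rn_convex n C"
    and "\<And>j. j \<in> J \<Longrightarrow> 0 \<le> w j" "sum w J = 1" "\<And>j. j \<in> J \<Longrightarrow> p j \<in> C"
  shows "(\<lambda>i\<in>{..<n}. \<Sum>j\<in>J. w j * p j i) \<in> C"
  using assms(1,3-5)
proof (induction J arbitrary: w rule: finite_induct)
  case empty
  then show ?case by simp
next
  case (insert k J)
  have pk: "p k \<in> C" and pR: "p k \<in> Rn n"
    using insert.prems C by (auto simp: Rn_convex_def)
  have wk: "0 \<le> w k" and wJ: "0 \<le> sum w J" and s1: "w k + sum w J = 1"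
    using insert.prems insert.hyps by (auto intro: sum_nonneg)
  show ?case
  proof (cases "sum w J = 0")
    case True
    then have "\<forall>j\<in>J. w j = 0"
      using insert.prems insert.hyps by (subst (asm) sum_nonneg_eq_0_iff) auto
    then have "(\<lambda>i\<in>{..<n}. \<Sum>j\<in>insert k J. w j * p j i) = p k"
      using insert.hyps s1 True pR by (auto simp: Rn_def PiE_iff extensional_def restrict_def)
    then show ?thesis using pk by simp
  next
    case False
    define z where "z = (\<lambda>j. w j / sum w J)"
    have "(\<lambda>i\<in>{..<n}. \<Sum>j\<in>J. z j * p j i) \<in> C"
      using insert.prems wJ False
      by (intro insert.IH) (auto simp: z_def sum_divide_distrib[symmetric])
    then have "Rn_lincomb n (w k) (p k) (sum w J) (\<lambda>i\<in>{..<n}. \<Sum>j\<in>J. z j * p j i) \<in> C"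
      using C pk wk wJ s1 unfolding Rn_convex_def by blast
    moreover have "Rn_lincomb n (w k) (p k) (sum w J) (\<lambda>i\<in>{..<n}. \<Sum>j\<in>J. z j * p j i)
        = (\<lambda>i\<in>{..<n}. \<Sum>j\<in>insert k J. w j * p j i)"
      using insert.hyps False
      by (auto simp: Rn_lincomb_def z_def sum_distrib_left fun_eq_iff restrict_def)
    ultimately show ?thesis by (simp only:)
  qed
qed

lemma sum_in_random_polytope:
  assumes "\<And>j. 0 \<le> w j" "sum w {..<N} = 1"
  shows "(\<lambda>i\<in>{..<n}. \<Sum>j<N. w j * X j i) \<in> random_polytope n N X"
  unfolding random_polytope_def hull_def
  using assms by (auto intro!: Rn_convex_sum)

lemma Rn_convex_halfspace: "Rn_convex n {y \<in> Rn n. c < (\<Sum>i<n. \<theta> i * y i)}"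
proof -
  have "c < (\<Sum>i<n. \<theta> i * Rn_lincomb n u x v y i)"
    if *: "c < (\<Sum>i<n. \<theta> i * x i)" "c < (\<Sum>i<n. \<theta> i * y i)" "0 \<le> u" "0 \<le> v" "u + v = 1"
    for x y u v
  proof -
    have "(\<Sum>i<n. \<theta> i * Rn_lincomb n u x v y i) = u * (\<Sum>i<n. \<theta> i * x i) + v * (\<Sum>i<n. \<theta> i * y i)"
      by (simp add: Rn_lincomb_def sum_distrib_left sum.distrib[symmetric] algebra_simps)
    moreover have "c = u * c + v * c" using *(5) by (metis distrib_right mult_1)
    moreover have "u * c + v * c < u * (\<Sum>i<n. \<theta> i * x i) + v * (\<Sum>i<n. \<theta> i * y i)"
    proof (cases "u = 0")
      case True then show ?thesis using * by auto
    next
      case False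
      then have "u * c < u * (\<Sum>i<n. \<theta> i * x i)" using * by simp
      moreover have "v * c \<le> v * (\<Sum>i<n. \<theta> i * y i)" using * by (intro mult_left_mono) auto
      ultimately show ?thesis by simp
    qed
    ultimately show ?thesis by simp
  qed
  then show ?thesis
    unfolding Rn_convex_def by (auto simp: Rn_lincomb_in_Rn)
qed

text \<open>Gordan's alternative for the vectors \<open>X j - x\<close>: a vanishing convex
  combination of them would write \<open>x\<close> as a convex combination of the points.
  Non-membership becomes a finite system of strict linear inequalities.\<close>

lemma notin_random_polytope_iff:
  assumes X: "\<And>j. j < N \<Longrightarrow> X j \<in> Rn n" and x: "x \<in> Rn n" and N: "N > 0"
  shows "x \<notin> random_polytope n N X \<longleftrightarrow> (\<exists>\<theta>. \<forall>j<N. (\<Sum>i<n. \<theta> i * x i) < (\<Sum>i<n. \<theta> i * X j i))"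
proof
  assume "\<exists>\<theta>. \<forall>j<N. (\<Sum>i<n. \<theta> i * x i) < (\<Sum>i<n. \<theta> i * X j i)"
  then obtain \<theta> where t: "\<forall>j<N. (\<Sum>i<n. \<theta> i * x i) < (\<Sum>i<n. \<theta> i * X j i)" by blast
  let ?H = "{y \<in> Rn n. (\<Sum>i<n. \<theta> i * x i) < (\<Sum>i<n. \<theta> i * y i)}"
  have "random_polytope n N X \<subseteq> ?H"
    unfolding random_polytope_def using t X
    by (intro hull_minimal Rn_convex_halfspace) auto
  then show "x \<notin> random_polytope n N X" by auto
next
  assume nx: "x \<notin> random_polytope n N X"
  have "\<not> (\<exists>w. (\<forall>j. 0 \<le> w j) \<and> sum w {..<N} = 1 \<and> (\<forall>i<n. (\<Sum>j<N. w j * (X j i - x i)) = 0))"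
  proof
    assume "\<exists>w. (\<forall>j. 0 \<le> w j) \<and> sum w {..<N} = 1 \<and> (\<forall>i<n. (\<Sum>j<N. w j * (X j i - x i)) = 0)"
    then obtain w where w: "\<forall>j. 0 \<le> w j" "sum w {..<N} = 1" "\<forall>i<n. (\<Sum>j<N. w j * (X j i - x i)) = 0"
      by blast
    have "x = (\<lambda>i\<in>{..<n}. \<Sum>j<N. w j * X j i)"
    proof
      fix i
      show "x i = (\<lambda>i\<in>{..<n}. \<Sum>j<N. w j * X j i) i"
      proof (cases "i < n")
        case True
        then have "0 = (\<Sum>j<N. w j * X j i) - (\<Sum>j<N. w j) * x i"
          using w(3) by (simp add: right_diff_distrib sum_subtractf sum_distrib_right)
        then show ?thesis using True w(2) by simp
      next
        case False then show ?thesis using x by (auto simp: Rn_def PiE_iff extensional_def)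
      qed
    qed
    then show False using nx sum_in_random_polytope[where w = w and N = N and n = n and X = X] w by simp
  qed
  moreover have ne: "{..<N} \<noteq> {}" using N by auto
  ultimately obtain \<theta> where "\<forall>j\<in>{..<N}. 0 < (\<Sum>i<n. \<theta> i * (X j i - x i))"
    using gordan_alternative[OF finite_lessThan ne, of n "\<lambda>j i. X j i - x i"] by blast
  then show "\<exists>\<theta>. \<forall>j<N. (\<Sum>i<n. \<theta> i * x i) < (\<Sum>i<n. \<theta> i * X j i)"
    by (intro exI[of _ \<theta>]) (auto simp: right_diff_distrib sum_subtractf)
qed

section \<open>From transversal covers to the expected measure\<close>

lemma coordinate_measurable:
  assumes "sets M = sets (Pi\<^sub>M {..<n} (\<lambda>_. borel :: real measure))" "i < n"
  shows "(\<lambda>y. y i) \<in> borel_measurable M"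
  using measurable_component_singleton[of i "{..<n}" "\<lambda>_. borel :: real measure"] assms
  by (simp cong: measurable_cong_sets)

lemma space_eq_Rn:
  assumes "sets M = sets (Pi\<^sub>M {..<n} (\<lambda>_. borel :: real measure))"
  shows "space M = Rn n"
  using sets_eq_imp_space_eq[OF assms] by (simp add: space_PiM Rn_def)

text \<open>Finitely many strict inequalities survive a small perturbation of \<theta>. This
  replaces an uncountable union over \<theta> by a countable one in the measurability proof.\<close>

lemma rational_separation:
  fixes v :: "'j \<Rightarrow> nat \<Rightarrow> real"
  assumes J: "finite J" and \<theta>: "\<And>j. j \<in> J \<Longrightarrow> 0 < (\<Sum>i<n. \<theta> i * v j i)"
  shows "\<exists>\<eta>\<in>{..<n} \<rightarrow>\<^sub>E \<rat>. \<forall>j\<in>J. 0 < (\<Sum>i<n. \<eta> i * v j i)"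
proof -
  have ex: "\<exists>f. (\<forall>k. f k \<in> \<rat>) \<and> f \<longlonglongrightarrow> x" for x :: real
  proof -
    have "\<exists>q\<in>\<rat>. x < q \<and> q < x + inverse (real (Suc k))" for k
      by (intro Rats_dense_in_real) simp
    then obtain f where f: "\<And>k. f k \<in> \<rat> \<and> x < f k \<and> f k < x + inverse (real (Suc k))" by metis
    have "(\<lambda>k. x + inverse (real (Suc k))) \<longlonglongrightarrow> x + 0"
      by (intro tendsto_intros LIMSEQ_inverse_real_of_nat)
    then have "f \<longlonglongrightarrow> x"
      using f by (intro tendsto_sandwich[of "\<lambda>_. x" f sequentially "\<lambda>k. x + inverse (real (Suc k))"])
        (auto intro!: always_eventually less_imp_le)
    then show ?thesis using f by blast
  qed
  obtain f where f: "\<And>i k. f i k \<in> \<rat>" "\<And>i. f i \<longlonglongrightarrow> \<theta> i"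
    using choice[of "\<lambda>i f. (\<forall>k. f k \<in> \<rat>) \<and> f \<longlonglongrightarrow> \<theta> i"] ex by blast
  have "\<forall>\<^sub>F k in sequentially. 0 < (\<Sum>i<n. f i k * v j i)" if "j \<in> J" for j
  proof -
    have "(\<lambda>k. \<Sum>i<n. f i k * v j i) \<longlonglongrightarrow> (\<Sum>i<n. \<theta> i * v j i)"
      by (intro tendsto_intros f)
    then show ?thesis using \<theta>[OF that] by (rule order_tendstoD)
  qed
  then have "\<forall>\<^sub>F k in sequentially. \<forall>j\<in>J. 0 < (\<Sum>i<n. f i k * v j i)"
    using J by (simp add: eventually_ball_finite)
  then obtain k where "\<forall>j\<in>J. 0 < (\<Sum>i<n. f i k * v j i)"
    by (auto simp: eventually_sequentially)
  then show ?thesis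
    using f by (intro bexI[of _ "\<lambda>i\<in>{..<n}. f i k"]) auto
qed

text \<open>Joint measurability in the sample and the point, as Fubini demands: the complement is a
  countable union, over rational \<theta>, of finite intersections of measurable sets.\<close>

lemma sets_random_polytope:
  assumes sets: "sets M = sets (Pi\<^sub>M {..<n} (\<lambda>_. borel :: real measure))" and N: "N > 0"
  shows "{p \<in> space (Pi\<^sub>M {..<N} (\<lambda>_. M) \<Otimes>\<^sub>M M). snd p \<in> random_polytope n N (fst p)}
    \<in> sets (Pi\<^sub>M {..<N} (\<lambda>_. M) \<Otimes>\<^sub>M M)"
proof -
  let ?P = "Pi\<^sub>M {..<N} (\<lambda>_. M) \<Otimes>\<^sub>M M"
  let ?Q = "{..<n} \<rightarrow>\<^sub>E \<rat> :: (nat \<Rightarrow> real) set"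
  define B where "B = (\<lambda>\<theta>. {p \<in> space ?P. \<forall>j\<in>{..<N}. (\<Sum>i<n. \<theta> i * snd p i) < (\<Sum>i<n. \<theta> i * fst p j i)})"
  have cQ: "countable ?Q" by (intro countable_PiE countable_rat) auto
  have m1: "(\<lambda>p. snd p i) \<in> borel_measurable ?P" if "i < n" for i
    using coordinate_measurable[OF sets that] by measurable
  have m2: "(\<lambda>p. fst p j i) \<in> borel_measurable ?P" if "i < n" "j < N" for i j
  proof -
    have "(\<lambda>p. fst p j) \<in> measurable ?P M"
      using that by (intro measurable_compose[OF measurable_fst measurable_component_singleton]) auto
    from measurable_compose[OF this coordinate_measurable[OF sets that(1)]] show ?thesis .
  qed
  have "B \<theta> \<in> sets ?P" for \<theta>
    unfolding B_def
    by (intro sets.sets_Collect_finite_All borel_measurable_less borel_measurable_sum borel_measurable_times m1 m2 borel_measurable_const) auto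
  then have U: "(\<Union>\<theta>\<in>?Q. B \<theta>) \<in> sets ?P"
    using cQ by (intro sets.countable_UN') auto
  have "{p \<in> space ?P. snd p \<in> random_polytope n N (fst p)} = space ?P - (\<Union>\<theta>\<in>?Q. B \<theta>)"
  proof -
    have "(snd p \<notin> random_polytope n N (fst p)) \<longleftrightarrow> (\<exists>\<theta>\<in>?Q. p \<in> B \<theta>)" if p: "p \<in> space ?P" for p
    proof -
      have X: "\<And>j. j < N \<Longrightarrow> fst p j \<in> Rn n" and x: "snd p \<in> Rn n"
        using p space_eq_Rn[OF sets] by (auto simp: space_pair_measure space_PiM)
      have "(snd p \<notin> random_polytope n N (fst p)) \<longleftrightarrow>
          (\<exists>\<theta>. \<forall>j<N. (\<Sum>i<n. \<theta> i * snd p i) < (\<Sum>i<n. \<theta> i * fst p j i))"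
        by (rule notin_random_polytope_iff[OF X x N])
      also have "\<dots> \<longleftrightarrow> (\<exists>\<theta>\<in>?Q. \<forall>j<N. (\<Sum>i<n. \<theta> i * snd p i) < (\<Sum>i<n. \<theta> i * fst p j i))"
        using rational_separation[where J = "{..<N}" and n = n and v = "\<lambda>j i. fst p j i - snd p i"]
        by (simp add: right_diff_distrib sum_subtractf Ball_def) blast
      also have "\<dots> \<longleftrightarrow> (\<exists>\<theta>\<in>?Q. p \<in> B \<theta>)"
        using p by (auto simp: B_def)
      finally show ?thesis .
    qed
    then show ?thesis by blast
  qed
  then show ?thesis using U by simp
qed

text \<open>Independence turns the probability that all \<open>N\<close> points avoid one
  \<open>U j\<close> into an \<open>N\<close>-th power; a union bound over \<open>J\<close> does the
  rest.\<close>

lemma prob_miss_le: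
  assumes "prob_space M" and J: "finite J"
    and U: "\<And>j. j \<in> J \<Longrightarrow> U j \<in> sets M" "\<And>j. j \<in> J \<Longrightarrow> \<delta> \<le> measure M (U j)"
  shows "measure (Pi\<^sub>M {..<N} (\<lambda>_. M)) (\<Union>j\<in>J. {..<N} \<rightarrow>\<^sub>E (space M - U j)) \<le> real (card J) * (1 - \<delta>) ^ N"
proof -
  interpret M: prob_space M by fact
  interpret P: finite_product_prob_space "\<lambda>_. M" "{..<N}" by unfold_locales auto
  have "measure (Pi\<^sub>M {..<N} (\<lambda>_. M)) ({..<N} \<rightarrow>\<^sub>E (space M - U j)) \<le> (1 - \<delta>) ^ N" if j: "j \<in> J" for j
  proof -
    have "measure (Pi\<^sub>M {..<N} (\<lambda>_. M)) ({..<N} \<rightarrow>\<^sub>E (space M - U j)) = (\<Prod>i<N. measure M (space M - U j))"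
      using U[OF j] by (intro P.finite_measure_PiM_emb) auto
    also have "\<dots> = (1 - measure M (U j)) ^ N"
      using U[OF j] by (simp add: M.prob_compl)
    also have "\<dots> \<le> (1 - \<delta>) ^ N"
      using U[OF j] by (intro power_mono) auto
    finally show ?thesis .
  qed
  then have "(\<Sum>j\<in>J. measure (Pi\<^sub>M {..<N} (\<lambda>_. M)) ({..<N} \<rightarrow>\<^sub>E (space M - U j))) \<le> (\<Sum>j\<in>J. (1 - \<delta>) ^ N)"
    by (intro sum_mono)
  moreover have "measure (Pi\<^sub>M {..<N} (\<lambda>_. M)) (\<Union>j\<in>J. {..<N} \<rightarrow>\<^sub>E (space M - U j)) \<le>
      (\<Sum>j\<in>J. measure (Pi\<^sub>M {..<N} (\<lambda>_. M)) ({..<N} \<rightarrow>\<^sub>E (space M - U j)))"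
    using J U by (intro measure_UNION_le) (auto intro!: sets_PiM_I_finite)
  ultimately show ?thesis by simp
qed

text \<open>In dual form: \<open>x\<close> lies in the convex hull of every choice of points \<open>p j \<in> U j\<close>.\<close>

definition transversal_cover :: "nat \<Rightarrow> 'j set \<Rightarrow> ('j \<Rightarrow> (nat \<Rightarrow> real) set) \<Rightarrow> (nat \<Rightarrow> real) \<Rightarrow> bool" where
  "transversal_cover n J U x \<longleftrightarrow> (\<forall>p. (\<forall>j\<in>J. p j \<in> U j) \<longrightarrow>
     (\<forall>\<theta>. \<exists>j\<in>J. (\<Sum>i<n. \<theta> i * p j i) \<le> (\<Sum>i<n. \<theta> i * x i)))"

text \<open>By Fubini the expectation is the integral over \<open>x\<close> of the probability that
  \<open>x\<close> is in the polytope, and on \<open>C\<close> this probability is bounded below by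
  \<open>prob_miss_le\<close>. The sets \<open>U j\<close> may vary with \<open>x\<close>; only
  \<open>J\<close> and \<delta> are uniform.\<close>

lemma expected_polytope_measure_ge:
  assumes pM: "prob_space M" and sets: "sets M = sets (Pi\<^sub>M {..<n} (\<lambda>_. borel :: real measure))"
    and N: "N > 0" and C: "C \<in> sets M" and J: "finite J" and \<delta>: "0 \<le> \<delta>" "\<delta> \<le> 1"
    and trans: "\<And>x. x \<in> C \<Longrightarrow>
      \<exists>U. (\<forall>j\<in>J. U j \<in> sets M \<and> \<delta> \<le> measure M (U j)) \<and> transversal_cover n J U x"
  shows "(1 - real (card J) * (1 - \<delta>) ^ N) * measure M C \<le> expected_polytope_measure n N M"
    and "expected_polytope_measure n N M \<le> 1"
proof -
  interpret M: prob_space M by fact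
  let ?P = "Pi\<^sub>M {..<N} (\<lambda>_. M)"
  interpret P: prob_space ?P by (intro prob_space_PiM pM)
  interpret PM: pair_sigma_finite ?P M by unfold_locales
  interpret PP: pair_prob_space ?P M by unfold_locales
  define q where "q = 1 - real (card J) * (1 - \<delta>) ^ N"
  define D where "D = {p \<in> space (?P \<Otimes>\<^sub>M M). snd p \<in> random_polytope n N (fst p)}"
  have D: "D \<in> sets (?P \<Otimes>\<^sub>M M)"
    unfolding D_def by (rule sets_random_polytope[OF sets N])
  have sp: "space M = Rn n" by (rule space_eq_Rn[OF sets])
  have X_Rn: "X j \<in> Rn n" if "X \<in> space ?P" "j < N" for X j
    using that sp by (auto simp: space_PiM)
  have sec: "Pair X -` D = random_polytope n N X" if X: "X \<in> space ?P" for X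
  proof -
    have "Rn_convex n (Rn n)" by (auto simp: Rn_convex_def Rn_lincomb_in_Rn)
    then have "random_polytope n N X \<subseteq> Rn n"
      unfolding random_polytope_def using X_Rn[OF X] by (intro hull_minimal) auto
    moreover have "Pair X -` D = {x \<in> Rn n. x \<in> random_polytope n N X}"
      using X sp by (simp add: D_def space_pair_measure vimage_def)
    ultimately show ?thesis by blast
  qed
  have m: "(\<lambda>X. measure M (Pair X -` D)) \<in> borel_measurable ?P"
    unfolding measure_def
    by (intro borel_measurable_enn2real M.measurable_emeasure_Pair D)
  have E: "expected_polytope_measure n N M = (\<integral>X. measure M (Pair X -` D) \<partial>?P)"
    unfolding expected_polytope_measure_def by (intro Bochner_Integration.integral_cong) (auto simp: sec)
  have int: "integrable ?P (\<lambda>X. measure M (Pair X -` D))"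
    by (rule P.integrable_const_bound[of _ 1]) (auto simp: m)
  have nonneg: "0 \<le> expected_polytope_measure n N M"
    unfolding E by (intro integral_nonneg_AE) auto
  show "expected_polytope_measure n N M \<le> 1"
    unfolding E using int by (intro P.integral_le_const) auto
  have hit: "q \<le> measure ?P ((\<lambda>X. (X, x)) -` D)" if x: "x \<in> C" for x
  proof -
    have xs: "x \<in> space M" using x C sets.sets_into_space by auto
    from trans[OF x] obtain U where U0: "\<forall>j\<in>J. U j \<in> sets M \<and> \<delta> \<le> measure M (U j)"
      and t0: "\<forall>p. (\<forall>j\<in>J. p j \<in> U j) \<longrightarrow> (\<forall>\<theta>. \<exists>j\<in>J. (\<Sum>i<n. \<theta> i * p j i) \<le> (\<Sum>i<n. \<theta> i * x i))"
      unfolding transversal_cover_def by (elim exE conjE)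
    have U: "\<And>j. j \<in> J \<Longrightarrow> U j \<in> sets M" "\<And>j. j \<in> J \<Longrightarrow> \<delta> \<le> measure M (U j)"
      using U0 by simp_all
    let ?A = "\<Union>j\<in>J. {..<N} \<rightarrow>\<^sub>E (space M - U j)"
    have A: "?A \<in> sets ?P"
      using J U(1) by (intro sets.finite_UN) (auto intro!: sets_PiM_I_finite)
    have "measure ?P ?A \<le> real (card J) * (1 - \<delta>) ^ N"
      by (rule prob_miss_le[OF pM J U])
    then have "q \<le> measure ?P (space ?P - ?A)"
      using P.prob_compl[OF A] by (simp add: q_def)
    also have "\<dots> \<le> measure ?P ((\<lambda>X. (X, x)) -` D)"
    proof (intro P.finite_measure_mono)
      show "space ?P - ?A \<subseteq> (\<lambda>X. (X, x)) -` D"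
      proof
        fix X assume X: "X \<in> space ?P - ?A"
        have "\<exists>k<N. X k \<in> U j" if "j \<in> J" for j
          using X that by (auto simp: space_PiM PiE_iff)
        \<comment> \<open>Every \<open>U j\<close> is hit by some sample point
          \<open>X (k j)\<close>. These points form a transversal, so no \<theta> can separate
          \<open>x\<close> from all of them.\<close>
        then obtain k where k: "\<And>j. j \<in> J \<Longrightarrow> k j < N \<and> X (k j) \<in> U j" by metis
        have "x \<in> random_polytope n N X"
        proof (rule ccontr)
          assume "x \<notin> random_polytope n N X"
          then obtain \<theta> where th: "\<forall>j<N. (\<Sum>i<n. \<theta> i * x i) < (\<Sum>i<n. \<theta> i * X j i)"
            using notin_random_polytope_iff[of N X n x] X_Rn[of X] X xs sp N by auto
          obtain j where "j \<in> J" "(\<Sum>i<n. \<theta> i * X (k j) i) \<le> (\<Sum>i<n. \<theta> i * x i)"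
            using t0[rule_format, of "\<lambda>j. X (k j)" \<theta>] k by blast
          then show False using th k[of j] by (metis not_less)
        qed
        then show "X \<in> (\<lambda>X. (X, x)) -` D"
          using X xs by (auto simp: D_def space_pair_measure)
      qed
      show "(\<lambda>X. (X, x)) -` D \<in> sets ?P" by (rule sets_Pair2[OF D])
    qed
    finally show ?thesis .
  qed
  have "ennreal (q * measure M C) \<le> ennreal (expected_polytope_measure n N M)" if "q \<ge> 0"
  proof -
    have "ennreal (q * measure M C) = (\<integral>\<^sup>+x. ennreal q * indicator C x \<partial>M)"
      using C that by (simp add: nn_integral_cmult_indicator ennreal_mult M.emeasure_eq_measure)
    also have "\<dots> \<le> (\<integral>\<^sup>+x. emeasure ?P ((\<lambda>X. (X, x)) -` D) \<partial>M)"
      using hit by (intro nn_integral_mono) (auto simp: P.emeasure_eq_measure split: split_indicator)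
    also have "\<dots> = emeasure (?P \<Otimes>\<^sub>M M) D"
      by (rule PM.emeasure_pair_measure_alt2[OF D, symmetric])
    also have "\<dots> = (\<integral>\<^sup>+X. emeasure M (Pair X -` D) \<partial>?P)"
      by (rule M.emeasure_pair_measure_alt[OF D])
    also have "\<dots> = (\<integral>\<^sup>+X. ennreal (measure M (Pair X -` D)) \<partial>?P)"
      by (simp add: M.emeasure_eq_measure)
    also have "\<dots> = ennreal (expected_polytope_measure n N M)"
      unfolding E using int by (intro nn_integral_eq_integral) auto
    finally show ?thesis .
  qed
  then show "(1 - real (card J) * (1 - \<delta>) ^ N) * measure M C \<le> expected_polytope_measure n N M"
    \<comment> \<open>For \<open>q < 0\<close> the left side is at most 0, and the expectation is
      nonnegative.\<close>
    using nonneg unfolding q_def[symmetric]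
    by (cases "q \<ge> 0") (auto intro: order_trans[OF mult_nonpos_nonneg])
qed

section \<open>Log-concave measures and their affine functionals\<close>

text \<open>The inequality is stated with a measurable superset \<open>C\<close> of the Minkowski
  combination, because the combination of two Borel sets itself need not be Borel.\<close>

locale log_concave_space = prob_space M for M :: "(nat \<Rightarrow> real) measure" +
  fixes n :: nat
  assumes sets_M: "sets M = sets (Pi\<^sub>M {..<n} (\<lambda>_. borel))"
    and log_concave: "\<lbrakk>A \<in> sets M; B \<in> sets M; C \<in> sets M; 0 < l; l < 1;
        \<And>x y. x \<in> A \<Longrightarrow> y \<in> B \<Longrightarrow> Rn_lincomb n l x (1 - l) y \<in> C\<rbrakk>
      \<Longrightarrow> prob A powr l * prob B powr (1 - l) \<le> prob C"
begin

lemma space_M: "space M = Rn n"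
  by (rule space_eq_Rn[OF sets_M])

lemma measurable_coordinate: "i < n \<Longrightarrow> (\<lambda>y. y i) \<in> borel_measurable M"
  by (rule coordinate_measurable[OF sets_M])

end

section \<open>Inner regularity: log-concavity passes from compact sets to Borel sets\<close>

lemma compactin_Rn_topology:
  assumes "compact K" "K \<subseteq> Rn n"
  shows "compactin (Rn_topology n) K"
proof -
  have "continuous_map euclidean (Rn_topology n) (\<lambda>f :: nat \<Rightarrow> real. restrict f {..<n})"
    unfolding Rn_topology_def continuous_map_componentwise
    by (auto intro: continuous_on_product_coordinates)
  then have "compactin (Rn_topology n) ((\<lambda>f. restrict f {..<n}) ` K)"
    using assms(1) by (intro image_compactin) auto
  moreover have "(\<lambda>f. restrict f {..<n}) ` K = K"
    using assms(2) unfolding Rn_def by (force simp: PiE_iff extensional_restrict)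
  ultimately show ?thesis by simp
qed

text \<open>Under the inclusion, \<open>M\<close> becomes a Borel measure on the Polish space
  \<open>nat \<Rightarrow> real\<close>, where \<open>inner_regular\<close> applies; compact subsets
  of \<open>Rn n\<close> there are also compact in \<open>Rn_topology n\<close>.\<close>

lemma Rn_inner_regular:
  assumes "finite_measure M" and sets: "sets M = sets (Pi\<^sub>M {..<n} (\<lambda>_. borel :: real measure))"
    and A: "A \<in> sets M" and a: "0 \<le> a" "a < measure M A"
  shows "\<exists>K\<subseteq>A. compactin (Rn_topology n) K \<and> a < measure M K"
proof -
  interpret finite_measure M by fact
  have sp: "space M = Rn n" by (rule space_eq_Rn[OF sets])
  have sb: "sets (borel :: (nat \<Rightarrow> real) measure) = sets (Pi\<^sub>M UNIV (\<lambda>_. borel))"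
    by (rule sets_PiM_equal_borel[symmetric])
  have id: "(\<lambda>x. x) \<in> measurable M (borel :: (nat \<Rightarrow> real) measure)"
    unfolding measurable_cong_sets[OF refl sb]
  proof (rule measurable_PiM_single')
    fix i
    show "(\<lambda>x. x i) \<in> borel_measurable M"
    proof (cases "i < n")
      case True then show ?thesis by (rule coordinate_measurable[OF sets])
    next
      case False
      then have "x i = undefined" if "x \<in> space M" for x
        using that sp by (auto simp: Rn_def PiE_iff extensional_def)
      then show ?thesis by (subst measurable_cong[of _ _ "\<lambda>_. undefined"]) auto
    qed
  qed (simp_all add: Pi_def)
  \<comment> \<open>Extensional functions have the fixed value \<open>undefined\<close> at every
    index from \<open>n\<close> on, which is a closed condition for each index.\<close>
  have Rn: "Rn n \<in> sets (borel :: (nat \<Rightarrow> real) measure)"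
  proof -
    have "x \<in> Rn n \<longleftrightarrow> (\<forall>i\<ge>n. x i = undefined)" for x
      by (simp add: Rn_def PiE_iff extensional_def not_less)
    then have "Rn n = (\<Inter>i\<in>{n..}. {x. x i = undefined})"
      by blast
    moreover have "closed {x :: nat \<Rightarrow> real. x i = undefined}" for i
      by (intro closed_Collect_eq continuous_intros continuous_on_product_coordinates)
    ultimately have "closed (Rn n)" by (simp add: closed_INT)
    then show ?thesis by simp
  qed
  have restr: "(\<lambda>x. restrict x {..<n}) \<in> measurable (borel :: (nat \<Rightarrow> real) measure) M"
    unfolding measurable_cong_sets[OF sb sets] by (intro measurable_restrict) auto
  have "A \<subseteq> Rn n" using A sets.sets_into_space sp by blast
  then have "A = ((\<lambda>x. restrict x {..<n}) -` A \<inter> space borel) \<inter> Rn n"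
    unfolding Rn_def by (auto simp: PiE_iff extensional_restrict)
  then have Ab: "A \<in> sets borel"
    using measurable_sets[OF restr A] Rn by (metis sets.Int)
  let ?D = "distr M borel (\<lambda>x. x)"
  have em: "emeasure ?D B = emeasure M (B \<inter> Rn n)" if "B \<in> sets borel" for B
    using id that by (simp add: emeasure_distr sp)
  have "emeasure ?D A = (SUP K\<in>{K. K \<subseteq> A \<and> compact K}. emeasure ?D K)"
    using Ab finite_measure.emeasure_finite[OF finite_measure_distr[OF id]]
    by (intro inner_regular) (auto simp: top_unique)
  moreover have "ennreal a < emeasure ?D A"
    using em[OF Ab] \<open>A \<subseteq> Rn n\<close> a by (simp add: Int_absorb2 emeasure_eq_measure ennreal_less_iff)
  ultimately obtain K where K: "K \<subseteq> A" "compact K" "ennreal a < emeasure ?D K"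
    by (auto simp: less_SUP_iff)
  have "K \<subseteq> Rn n" using K \<open>A \<subseteq> Rn n\<close> by blast
  moreover have "emeasure ?D K = ennreal (measure M K)"
    using em[of K] K \<open>K \<subseteq> Rn n\<close> by (simp add: Int_absorb2 emeasure_eq_measure borel_compact)
  ultimately show ?thesis
    using K compactin_Rn_topology[of K n] a by (auto simp: ennreal_less_iff)
qed

text \<open>Inner compact sets carrying a proportion \<open>c < 1\<close> of each mass suffice: the
  product of the powers is homogeneous of degree \<open>l + (1 - l) = 1\<close>, so the loss is
  exactly the factor \<open>c\<close>, which tends to 1.\<close>

lemma log_concave_prob_imp_space:
  assumes "log_concave_prob n M"
  shows "log_concave_space M n"
proof -
  have pM: "prob_space M" and sets: "sets M = sets (Pi\<^sub>M {..<n} (\<lambda>_. borel))"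
    and lc: "\<And>A B l. \<lbrakk>compactin (Rn_topology n) A; compactin (Rn_topology n) B; 0 < l; l < 1\<rbrakk> \<Longrightarrow>
        measure M A powr l * measure M B powr (1 - l)
          \<le> measure M {Rn_lincomb n l x (1 - l) y |x y. x \<in> A \<and> y \<in> B}"
    using assms unfolding log_concave_prob_def by (auto simp: sets_Rn_borel)
  interpret prob_space M by fact
  show ?thesis
  proof (unfold_locales, rule sets)
    fix A B C and l :: real
    assume A: "A \<in> events" and B: "B \<in> events" and C: "C \<in> events" and l: "0 < l" "l < 1"
      and comb: "\<And>x y. x \<in> A \<Longrightarrow> y \<in> B \<Longrightarrow> Rn_lincomb n l x (1 - l) y \<in> C"
    show "prob A powr l * prob B powr (1 - l) \<le> prob C"
    proof (cases "prob A = 0 \<or> prob B = 0")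
      case True then show ?thesis using l by auto
    next
      case False
      then have pos: "prob A > 0" "prob B > 0" by (simp_all add: zero_less_measure_iff)
      show ?thesis
      proof (rule field_le_mult_one_interval)
        fix c :: real assume c: "0 < c" "c < 1"
        obtain K where K: "K \<subseteq> A" "compactin (Rn_topology n) K" "c * prob A < prob K"
          using Rn_inner_regular[OF finite_measure_axioms sets A, of "c * prob A"] c pos by auto
        obtain L where L: "L \<subseteq> B" "compactin (Rn_topology n) L" "c * prob B < prob L"
          using Rn_inner_regular[OF finite_measure_axioms sets B, of "c * prob B"] c pos by auto
        let ?S = "{Rn_lincomb n l x (1 - l) y |x y. x \<in> K \<and> y \<in> L}"
        have "c * (prob A powr l * prob B powr (1 - l)) = (c * prob A) powr l * (c * prob B) powr (1 - l)"
          using c pos by (simp add: powr_mult powr_add[symmetric] algebra_simps)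
        also have "\<dots> \<le> prob K powr l * prob L powr (1 - l)"
          using K L c l pos by (intro mult_mono powr_mono2) auto
        also have "\<dots> \<le> prob ?S" by (rule lc[OF K(2) L(2) l])
        also have "\<dots> \<le> prob C"
          using K L comb C by (intro finite_measure_mono) auto
        finally show "c * (prob A powr l * prob B powr (1 - l)) \<le> prob C" .
      qed
    qed
  qed
qed

text \<open>Against the tail \<open>(1/3)^k\<close> of \<open>affine_tail\<close> this leaves a
  geometric series of ratio 2/3. The quotient of the square by \<open>2^k\<close> is largest at
  \<open>k = 1\<close>, where it is 25/2.\<close>

lemma odd_square_le_power2: "(2 * real k + 3)\<^sup>2 \<le> 13 * 2 ^ k"
proof (induction k)
  case (Suc k)
  \<comment> \<open>The square more than doubles from \<open>k = 0\<close> to \<open>k = 1\<close>,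
    so that step is checked numerically.\<close>
  have "(2 * real (Suc k) + 3)\<^sup>2 \<le> 2 * (2 * real k + 3)\<^sup>2" if "k \<ge> 1"
  proof -
    have "1 * 1 \<le> real k * real k" using that by (intro mult_mono) auto
    then show ?thesis using that by (simp add: power2_eq_square algebra_simps)
  qed
  then show ?case
    using Suc by (cases "k = 0") auto
qed simp

section \<open>Exponential tails and second moments of affine functionals\<close>

context log_concave_space begin

definition affine_functional :: "((nat \<Rightarrow> real) \<Rightarrow> real) \<Rightarrow> bool" where
  "affine_functional f \<longleftrightarrow> f \<in> borel_measurable M \<and>
     (\<forall>l x y. f (Rn_lincomb n l x (1 - l) y) = l * f x + (1 - l) * f y)"

lemma affine_functional_sum:
  "affine_functional (\<lambda>y. \<Sum>i<n. a i * (y i - c i))"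
proof -
  have "a i * ((l * x i + (1 - l) * y i) - c i) = l * (a i * (x i - c i)) + (1 - l) * (a i * (y i - c i))"
    for l and x y :: "nat \<Rightarrow> real" and i
    by (simp add: algebra_simps)
  then have "(\<Sum>i<n. a i * (Rn_lincomb n l x (1 - l) y i - c i)) =
      l * (\<Sum>i<n. a i * (x i - c i)) + (1 - l) * (\<Sum>i<n. a i * (y i - c i))" for l x y
    unfolding sum_distrib_left sum.distrib[symmetric] by (intro sum.cong) (auto simp: Rn_lincomb_def)
  moreover have "(\<lambda>y. \<Sum>i<n. a i * (y i - c i)) \<in> borel_measurable M"
    by (intro borel_measurable_sum borel_measurable_times borel_measurable_diff measurable_coordinate) auto
  ultimately show ?thesis
    unfolding affine_functional_def by blast
qed

text \<open>If \<open>\<bar>f x\<bar> > (2k+1)a\<close> and \<open>\<bar>f y\<bar> \<le> a\<close>, then \<open>\<bar>f\<bar> > a\<close> at the point \<open>(x + k y)/(k+1)\<close>.\<close>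

lemma affine_tail:
  assumes f: "affine_functional f" and a: "0 < a" "prob {x \<in> space M. a < \<bar>f x\<bar>} \<le> 1 / 4"
  shows "prob {x \<in> space M. (2 * real k + 1) * a < \<bar>f x\<bar>} \<le> 1 / 4 * (1 / 3) ^ k"
proof (cases "k = 0")
  case True then show ?thesis using a by simp
next
  case False
  have [measurable]: "f \<in> borel_measurable M" using f by (simp add: affine_functional_def)
  define l where "l = 1 / (real k + 1)"
  have l: "0 < l" "l < 1" using False by (auto simp: l_def)
  have l1: "l * (real k + 1) = 1"
    unfolding l_def by (simp add: add_nonneg_eq_0_iff)
  then have lk: "l * (2 * real k + 1) - (1 - l) = 1" "1 - l = l * real k" "l * (real k + 1) = 1"
    by (simp_all add: algebra_simps)
  let ?A = "{x \<in> space M. (2 * real k + 1) * a < \<bar>f x\<bar>}"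
  let ?B = "space M - {x \<in> space M. a < \<bar>f x\<bar>}"
  have "prob ?A powr l * prob ?B powr (1 - l) \<le> prob {x \<in> space M. a < \<bar>f x\<bar>}"
  proof (rule log_concave)
    fix x y assume x: "x \<in> ?A" and y: "y \<in> ?B"
    have "a = l * ((2 * real k + 1) * a) - (1 - l) * a"
      using lk(1) by (metis left_diff_distrib mult.assoc mult_1)
    also have "\<dots> < l * \<bar>f x\<bar> - (1 - l) * \<bar>f y\<bar>"
    proof -
      have "l * ((2 * real k + 1) * a) < l * \<bar>f x\<bar>"
        using x l by (intro mult_strict_left_mono) auto
      moreover have "(1 - l) * \<bar>f y\<bar> \<le> (1 - l) * a"
        using y l by (intro mult_left_mono) auto
      ultimately show ?thesis by linarith
    qed
    also have "\<dots> \<le> \<bar>l * f x + (1 - l) * f y\<bar>"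
      using l abs_triangle_ineq2[of "l * f x" "- ((1 - l) * f y)"] by (simp add: abs_mult)
    finally show "Rn_lincomb n l x (1 - l) y \<in> {x \<in> space M. a < \<bar>f x\<bar>}"
      using f by (simp add: affine_functional_def space_M Rn_lincomb_in_Rn)
  qed (use l in auto)
  also have "\<dots> \<le> 1 / 4" by (rule a)
  finally have 1: "prob ?A powr l * prob ?B powr (1 - l) \<le> 1 / 4" .
  have B: "3 / 4 \<le> prob ?B" using a by (subst prob_compl) auto
  \<comment> \<open>As in Borell's lemma: the power \<open>k + 1\<close>, which is
    \<open>1 / l\<close>, turns the exponents \<open>l\<close> and \<open>1 - l\<close> into 1 and
    \<open>k\<close>. Since \<open>?B\<close> has mass at least 3/4, the bound
    \<open>(1/4)^(k+1) / (3/4)^k\<close> results.\<close>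
  have "prob ?A * prob ?B ^ k = (prob ?A powr l * prob ?B powr (1 - l)) powr (real k + 1)"
  proof -
    have "(1 - l) * (real k + 1) = real k" using lk(2) l1 by (simp add: algebra_simps)
    then show ?thesis
      using B l1 by (simp add: powr_mult powr_powr powr_realpow)
  qed
  also have "\<dots> \<le> (1 / 4) powr (real k + 1)"
    using 1 by (intro powr_mono2) auto
  also have "\<dots> = (1 / 4) ^ (k + 1)" by (subst powr_realpow[symmetric]) (auto simp: add.commute)
  finally have 2: "prob ?A * prob ?B ^ k \<le> (1 / 4) ^ (k + 1)" .
  have "prob ?A * (3 / 4) ^ k \<le> prob ?A * prob ?B ^ k"
    using B by (intro mult_left_mono power_mono) auto
  with 2 have "prob ?A * (3 / 4) ^ k \<le> (1 / 4) ^ (k + 1)" by simp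
  then have "prob ?A \<le> (1 / 4) ^ (k + 1) / (3 / 4) ^ k" by (simp add: pos_le_divide_eq)
  also have "\<dots> = 1 / 4 * (1 / 3) ^ k" by (simp add: field_simps power_divide)
  finally show ?thesis .
qed

text \<open>On the shell from \<open>(2k+1) a\<close> to \<open>(2k+3) a\<close> the square is at
  most \<open>(2k+3)^2 a^2\<close>. Summing these values against the tails gives
  \<open>a^2 + 13/4 * 3 * a^2 = 43/4 * a^2\<close>.\<close>

lemma affine_second_moment:
  assumes f: "affine_functional f" and a: "0 < a" "prob {x \<in> space M. a < \<bar>f x\<bar>} \<le> 1 / 4"
  shows "integrable M (\<lambda>x. (f x)\<^sup>2)" "expectation (\<lambda>x. (f x)\<^sup>2) \<le> 11 * a\<^sup>2"
proof -
  have [measurable]: "f \<in> borel_measurable M" using f by (simp add: affine_functional_def)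
  define A where "A = (\<lambda>k::nat. {x \<in> space M. (2 * real k + 1) * a < \<bar>f x\<bar>})"
  have [measurable]: "A k \<in> sets M" for k unfolding A_def by measurable
  have pw: "ennreal ((f x)\<^sup>2) \<le> ennreal (a\<^sup>2) + (\<Sum>k. ennreal ((2 * real k + 3)\<^sup>2 * a\<^sup>2) * indicator (A k) x)"
    if x: "x \<in> space M" for x
  proof (cases "\<bar>f x\<bar> \<le> a")
    case True
    then have "(f x)\<^sup>2 \<le> a\<^sup>2" by (rule abs_le_square_iff[THEN iffD1, rotated -1, OF _ , of _ a, simplified] | simp add: abs_le_square_iff[symmetric])+
    then show ?thesis by (intro add_increasing2) (auto intro: ennreal_leI)
  next
    case False
    \<comment> \<open>The index of the shell containing \<open>\<bar>f x\<bar>\<close>; shells are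
      open below and closed above, hence a ceiling minus one and not a floor.\<close>
    define k where "k = nat (\<lceil>(\<bar>f x\<bar> / a - 1) / 2\<rceil> - 1)"
    have "0 < (\<bar>f x\<bar> / a - 1) / 2" using False a by (simp add: field_simps)
    then have "real k = of_int \<lceil>(\<bar>f x\<bar> / a - 1) / 2\<rceil> - 1"
      unfolding k_def by (subst of_nat_nat) auto
    then have "real k < (\<bar>f x\<bar> / a - 1) / 2" "(\<bar>f x\<bar> / a - 1) / 2 \<le> real k + 1"
      using ceiling_correct[of "(\<bar>f x\<bar> / a - 1) / 2"] by linarith+
    then have k: "(2 * real k + 1) * a < \<bar>f x\<bar>" "\<bar>f x\<bar> \<le> (2 * real k + 3) * a"
      using a by (simp_all add: field_simps)
    have "(f x)\<^sup>2 \<le> ((2 * real k + 3) * a)\<^sup>2"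
      using k(2) a by (simp add: abs_le_square_iff[symmetric])
    then have "ennreal ((f x)\<^sup>2) \<le> ennreal ((2 * real k + 3)\<^sup>2 * a\<^sup>2) * indicator (A k) x"
      using k(1) x by (auto simp: A_def power_mult_distrib intro: ennreal_leI)
    also have "\<dots> \<le> (\<Sum>k. ennreal ((2 * real k + 3)\<^sup>2 * a\<^sup>2) * indicator (A k) x)"
    proof -
      have "g k \<le> suminf g" for g :: "nat \<Rightarrow> ennreal"
        using sum_le_suminf[of g "{k}"] by simp
      then show ?thesis .
    qed
    finally show ?thesis by (simp add: add_increasing)
  qed
  have term_le: "ennreal ((2 * real k + 3)\<^sup>2 * a\<^sup>2) * emeasure M (A k) \<le> ennreal (13 / 4 * a\<^sup>2 * (2 / 3) ^ k)" for k
  proof -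
    have "(2 * real k + 3)\<^sup>2 * a\<^sup>2 * prob (A k) \<le> (13 * 2 ^ k) * a\<^sup>2 * (1 / 4 * (1 / 3) ^ k)"
      using affine_tail[OF f a, of k] odd_square_le_power2[of k]
      by (intro mult_mono) (auto simp: A_def)
    also have "\<dots> = 13 / 4 * a\<^sup>2 * (2 / 3) ^ k" by (simp add: power_divide)
    finally show ?thesis by (simp add: emeasure_eq_measure ennreal_mult[symmetric] ennreal_leI)
  qed
  have "(\<integral>\<^sup>+x. ennreal ((f x)\<^sup>2) \<partial>M)
      \<le> (\<integral>\<^sup>+x. ennreal (a\<^sup>2) + (\<Sum>k. ennreal ((2 * real k + 3)\<^sup>2 * a\<^sup>2) * indicator (A k) x) \<partial>M)"
    by (intro nn_integral_mono pw)
  also have "\<dots> = ennreal (a\<^sup>2) + (\<Sum>k. ennreal ((2 * real k + 3)\<^sup>2 * a\<^sup>2) * emeasure M (A k))"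
    by (simp add: nn_integral_add nn_integral_suminf nn_integral_cmult_indicator emeasure_space_1)
  also have "\<dots> \<le> ennreal (a\<^sup>2) + (\<Sum>k. ennreal (13 / 4 * a\<^sup>2 * (2 / 3) ^ k))"
    by (intro add_left_mono suminf_le term_le) auto
  also have "(\<Sum>k. ennreal (13 / 4 * a\<^sup>2 * (2 / 3) ^ k)) = ennreal (39 / 4 * a\<^sup>2)"
  proof -
    have "(\<lambda>k. 13 / 4 * a\<^sup>2 * (2 / 3) ^ k) sums (13 / 4 * a\<^sup>2 * (1 / (1 - 2 / 3)))"
      by (intro sums_mult geometric_sums) auto
    then show ?thesis by (intro suminf_ennreal_eq) auto
  qed
  also have "ennreal (a\<^sup>2) + ennreal (39 / 4 * a\<^sup>2) = ennreal (43 / 4 * a\<^sup>2)"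
    by (simp add: ennreal_plus[symmetric] del: ennreal_plus)
  finally have le: "(\<integral>\<^sup>+x. ennreal ((f x)\<^sup>2) \<partial>M) \<le> ennreal (43 / 4 * a\<^sup>2)" .
  show int: "integrable M (\<lambda>x. (f x)\<^sup>2)"
    using le by (intro integrableI_bounded) (auto intro: le_less_trans simp: less_top[symmetric] top_unique)
  have "ennreal (expectation (\<lambda>x. (f x)\<^sup>2)) \<le> ennreal (43 / 4 * a\<^sup>2)"
    using le int by (subst nn_integral_eq_integral[symmetric]) auto
  then have "expectation (\<lambda>x. (f x)\<^sup>2) \<le> 43 / 4 * a\<^sup>2"
    by (subst (asm) ennreal_le_iff) auto
  also have "\<dots> \<le> 11 * a\<^sup>2" by (intro mult_right_mono) auto
  finally show "expectation (\<lambda>x. (f x)\<^sup>2) \<le> 11 * a\<^sup>2" .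
qed

text \<open>A real random variable exceeds some finite level with probability below 1/4, and this is
  all that the tail bound requires. Thus log-concavity alone provides the moments.\<close>

lemma affine_square_integrable:
  assumes f: "affine_functional f"
  shows "integrable M (\<lambda>x. (f x)\<^sup>2)"
proof -
  have [measurable]: "f \<in> borel_measurable M" using f by (simp add: affine_functional_def)
  define A where "A = (\<lambda>k::nat. {x \<in> space M. real k < \<bar>f x\<bar>})"
  have "(\<lambda>k. prob (A k)) \<longlonglongrightarrow> prob (\<Inter>k. A k)"
  proof (rule finite_Lim_measure_decseq)
    show "range A \<subseteq> events" unfolding A_def by auto
    show "decseq A" unfolding A_def decseq_def by (auto intro: le_less_trans)
  qed
  moreover have "(\<Inter>k. A k) = {}"
  proof -
    have "\<exists>k. x \<notin> A k" for x
      using reals_Archimedean2[of "\<bar>f x\<bar>"] by (auto simp: A_def not_less intro: less_imp_le)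
    then show ?thesis by blast
  qed
  ultimately have "(\<lambda>k. prob (A k)) \<longlonglongrightarrow> 0" by simp
  then have "\<forall>\<^sub>F k in sequentially. prob (A k) < 1 / 4"
    by (rule order_tendstoD) simp
  then obtain k where k: "prob (A (Suc k)) < 1 / 4"
    by (auto simp: eventually_sequentially intro: le_SucI)
  show ?thesis
    by (rule affine_second_moment(1)[OF f, of "real (Suc k)"]) (use k in \<open>auto simp: A_def\<close>)
qed

end

section \<open>Isotropic position\<close>

text \<open>Forward substitution. Injectivity of the isotropic change of coordinates is used in this
  form, without an inverse matrix.\<close>

lemma triangular_kernel_trivial:
  fixes a :: "nat \<Rightarrow> nat \<Rightarrow> real"
  assumes diag: "\<And>k. k < n \<Longrightarrow> a k k \<noteq> 0" and tri: "\<And>k i. k < n \<Longrightarrow> k < i \<Longrightarrow> a k i = 0"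
    and ker: "\<And>k. k < n \<Longrightarrow> (\<Sum>i<n. a k i * d i) = 0" and "i < n"
  shows "d i = 0"
  using \<open>i < n\<close>
proof (induction i rule: less_induct)
  case (less k)
  have "a k i * d i = 0" if "i \<in> {..<n} - {k}" for i
    using that less tri[of k i] by (cases i k rule: linorder_cases) auto
  then have "(\<Sum>i\<in>{..<n}. a k i * d i) = (\<Sum>i\<in>{k}. a k i * d i)"
    using less.prems by (intro sum.mono_neutral_right) auto
  then show ?case using ker[OF less.prems] diag[OF less.prems] by simp
qed

text \<open>Gram-Schmidt on the standard basis. Processing the basis in order makes the result
  triangular with nonzero diagonal, so that invertibility is visible from the entries.\<close>

lemma gram_schmidt_triangular:
  fixes B :: "(nat \<Rightarrow> real) \<Rightarrow> (nat \<Rightarrow> real) \<Rightarrow> real"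
  assumes sym: "\<And>x y. B x y = B y x"
    and lin: "\<And>x y z t. B (\<lambda>i. x i + t * y i) z = B x z + t * B y z"
    and pos: "\<And>x. \<exists>i<n. x i \<noteq> 0 \<Longrightarrow> 0 < B x x"
  shows "\<exists>a. (\<forall>j<n. a j j \<noteq> 0 \<and> (\<forall>i>j. a j i = 0) \<and> (\<forall>k<n. B (a j) (a k) = (if j = k then 1 else 0)))"
proof -
  have scale: "B (\<lambda>i. t * x i) z = t * B x z" for t x z
    using lin[of x "t - 1" x z] by (simp add: algebra_simps)
  have comb: "B (\<lambda>i. x i - (\<Sum>j\<in>J. c j * y j i)) z = B x z - (\<Sum>j\<in>J. c j * B (y j) z)"
    if "finite J" for x z c and y :: "nat \<Rightarrow> nat \<Rightarrow> real" and J
    using that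
  proof (induction J rule: finite_induct)
    case (insert k J)
    have "B (\<lambda>i. x i - (\<Sum>j\<in>insert k J. c j * y j i)) z
        = B (\<lambda>i. (x i - (\<Sum>j\<in>J. c j * y j i)) + (- c k) * y k i) z"
      using insert.hyps by (simp add: algebra_simps)
    also have "\<dots> = B (\<lambda>i. x i - (\<Sum>j\<in>J. c j * y j i)) z + (- c k) * B (y k) z"
      by (rule lin)
    finally show ?case using insert by simp
  qed simp
  have "\<exists>a. (\<forall>j<m. a j j \<noteq> 0 \<and> (\<forall>i>j. a j i = 0) \<and> (\<forall>k<m. B (a j) (a k) = (if j = k then 1 else 0)))"
    if "m \<le> n" for m
    using that
  proof (induction m)
    case (Suc m)
    then obtain a where a: "\<And>j. j < m \<Longrightarrow> a j j \<noteq> 0" "\<And>j i. j < m \<Longrightarrow> j < i \<Longrightarrow> a j i = 0"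
      "\<And>j k. j < m \<Longrightarrow> k < m \<Longrightarrow> B (a j) (a k) = (if j = k then 1 else 0)"
      by auto
    define e where "e = (\<lambda>i. if i = m then 1 else 0 :: real)"
    define g where "g = (\<lambda>i. e i - (\<Sum>j<m. B e (a j) * a j i))"
    \<comment> \<open>The earlier vectors vanish at coordinate \<open>m\<close>, so the residual
      keeps the entry 1 there; it is nonzero and can be normalised.\<close>
    have g_m: "g m = 1" using a(2) by (simp add: g_def e_def)
    have g_gt: "g i = 0" if "m < i" for i using a(2) that by (simp add: g_def e_def)
    have g_orth: "B g (a l) = 0" if "l < m" for l
    proof -
      have "(\<Sum>j<m. B e (a j) * B (a j) (a l)) = (\<Sum>j<m. if j = l then B e (a l) else 0)"
        using a(3) that by (intro sum.cong) auto
      then show ?thesis using that unfolding g_def by (simp add: comb)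
    qed
    have gg: "0 < B g g" using g_m Suc.prems by (intro pos exI[of _ m]) auto
    define s where "s = 1 / sqrt (B g g)"
    define b where "b = a(m := (\<lambda>i. s * g i))"
    have s: "s \<noteq> 0" "s * s * B g g = 1" using gg by (auto simp: s_def)
    have scale2: "B z (\<lambda>i. t * x i) = t * B z x" for t x z
      using scale sym by metis
    have "b j j \<noteq> 0 \<and> (\<forall>i>j. b j i = 0) \<and> (\<forall>k<Suc m. B (b j) (b k) = (if j = k then 1 else 0))"
      if j: "j < Suc m" for j
    proof (intro conjI allI impI)
      show "b j j \<noteq> 0" using a(1) j s g_m by (auto simp: b_def less_Suc_eq)
      show "b j i = 0" if "j < i" for i using a(2) j that g_gt by (auto simp: b_def less_Suc_eq)
      fix k assume k: "k < Suc m"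
      show "B (b j) (b k) = (if j = k then 1 else 0)"
        using a(3)[of j k] j k g_orth[of j] g_orth[of k] s sym[of "a j" g]
        by (auto simp: b_def less_Suc_eq scale scale2)
    qed
    then show ?case by blast
  qed simp
  from this[of n] show ?thesis by simp
qed

locale isotropic_space = log_concave_space +
  assumes mean_zero: "i < n \<Longrightarrow> expectation (\<lambda>y. y i) = 0"
    and covariance_id: "i < n \<Longrightarrow> j < n \<Longrightarrow> expectation (\<lambda>y. y i * y j) = (if i = j then 1 else 0)"

context log_concave_space begin

lemma affine_coordinate:
  assumes "i < n" shows "affine_functional (\<lambda>y. y i)"
  using assms by (simp add: affine_functional_def Rn_lincomb_def measurable_coordinate)

lemma integrable_affine_mult:
  assumes f: "affine_functional f" and g: "affine_functional g"
  shows "integrable M (\<lambda>x. f x * g x)"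
proof (rule Bochner_Integration.integrable_bound)
  show "integrable M (\<lambda>x. (f x)\<^sup>2 + (g x)\<^sup>2)"
    by (intro Bochner_Integration.integrable_add affine_square_integrable f g)
  show "(\<lambda>x. f x * g x) \<in> borel_measurable M"
    using f g by (intro borel_measurable_times) (simp_all add: affine_functional_def)
  have "\<bar>u * v\<bar> \<le> u\<^sup>2 + v\<^sup>2" for u v :: real
  proof -
    have "0 \<le> \<bar>u\<bar> * \<bar>v\<bar>" by simp
    then show ?thesis using sum_squares_bound[of "\<bar>u\<bar>" "\<bar>v\<bar>"] unfolding abs_mult power2_abs by linarith
  qed
  then show "AE x in M. norm (f x * g x) \<le> norm ((f x)\<^sup>2 + (g x)\<^sup>2)"
    by simp
qed

lemma integrable_affine:
  assumes f: "affine_functional f" shows "integrable M f"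
proof (rule square_integrable_imp_integrable)
  show "f \<in> borel_measurable M" using f by (simp add: affine_functional_def)
  show "integrable M (\<lambda>x. (f x)\<^sup>2)" by (rule affine_square_integrable[OF f])
qed

lemma affine_transform_space:
  assumes T: "T \<in> measurable M (Pi\<^sub>M {..<n} (\<lambda>_. borel))"
    and aff: "\<And>l x y. T (Rn_lincomb n l x (1 - l) y) = Rn_lincomb n l (T x) (1 - l) (T y)"
  shows "log_concave_space (distr M (Pi\<^sub>M {..<n} (\<lambda>_. borel)) T) n"
proof -
  let ?D = "distr M (Pi\<^sub>M {..<n} (\<lambda>_. borel)) T"
  interpret D: prob_space ?D by (rule prob_space_distr[OF T])
  show ?thesis
  proof (unfold_locales)
    show "sets ?D = sets (Pi\<^sub>M {..<n} (\<lambda>_. borel))" by simp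
    fix A B C and l :: real
    assume A: "A \<in> sets ?D" and B: "B \<in> sets ?D" and C: "C \<in> sets ?D" and l: "0 < l" "l < 1"
      and comb: "\<And>x y. x \<in> A \<Longrightarrow> y \<in> B \<Longrightarrow> Rn_lincomb n l x (1 - l) y \<in> C"
    have pre: "T -` X \<inter> space M \<in> events" if "X \<in> sets ?D" for X
      using that by (intro measurable_sets[OF T]) simp
    have "prob (T -` A \<inter> space M) powr l * prob (T -` B \<inter> space M) powr (1 - l) \<le> prob (T -` C \<inter> space M)"
    proof (rule log_concave[OF pre[OF A] pre[OF B] pre[OF C] l])
      fix x y assume "x \<in> T -` A \<inter> space M" "y \<in> T -` B \<inter> space M"
      then show "Rn_lincomb n l x (1 - l) y \<in> T -` C \<inter> space M"
        using comb aff by (simp add: space_M Rn_lincomb_in_Rn)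
    qed
    then show "D.prob A powr l * D.prob B powr (1 - l) \<le> D.prob C"
      using A B C by (simp add: measure_distr[OF T])
  qed
qed

text \<open>Gram-Schmidt for the covariance form \<open>Q\<close>. The form is positive definite
  because a direction of variance 0 would concentrate \<open>M\<close> on a hyperplane.\<close>

lemma isotropic_position:
  assumes hyp: "\<And>H. Rn_hyperplane n H \<Longrightarrow> prob H < 1"
  shows "\<exists>a c. (\<forall>j<n. a j j \<noteq> (0::real) \<and> (\<forall>i>j. a j i = 0)) \<and>
    (\<lambda>y. \<lambda>j\<in>{..<n}. \<Sum>i<n. a j i * (y i - c i)) \<in> measurable M (Pi\<^sub>M {..<n} (\<lambda>_. borel)) \<and>
    isotropic_space (distr M (Pi\<^sub>M {..<n} (\<lambda>_. borel)) (\<lambda>y. \<lambda>j\<in>{..<n}. \<Sum>i<n. a j i * (y i - c i))) n"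
proof -
  define c where "c = (\<lambda>i. expectation (\<lambda>y. y i))"
  define f where "f = (\<lambda>a y. \<Sum>i<n. a i * (y i - c i))"
  define Q where "Q = (\<lambda>a b. expectation (\<lambda>y. f a y * f b y))"
  have aff: "affine_functional (f a)" for a
    unfolding f_def by (rule affine_functional_sum)
  have f_lin: "f (\<lambda>i. x i + t * y i) z = f x z + t * f y z" for x t y z
    by (simp add: f_def algebra_simps sum.distrib sum_distrib_left sum_subtractf)
  have sym: "Q x y = Q y x" for x y by (simp add: Q_def mult.commute)
  have lin: "Q (\<lambda>i. x i + t * y i) z = Q x z + t * Q y z" for x y z t
    unfolding Q_def f_lin
    using integrable_affine_mult[OF aff[of x] aff[of z]] integrable_affine_mult[OF aff[of y] aff[of z]]
    by (simp add: distrib_right mult.assoc)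
  have pos: "0 < Q x x" if "\<exists>i<n. x i \<noteq> 0" for x
  proof (rule ccontr)
    assume "\<not> 0 < Q x x"
    moreover have "0 \<le> Q x x" unfolding Q_def by (intro integral_nonneg_AE) auto
    ultimately have "expectation (\<lambda>y. f x y * f x y) = 0" unfolding Q_def by linarith
    then have "AE y in M. f x y * f x y = 0"
      using integrable_affine_mult[OF aff aff, of x x] by (subst (asm) integral_nonneg_eq_0_iff_AE) auto
    then have ae: "AE y in M. y \<in> {y \<in> Rn n. (\<Sum>i<n. x i * y i) = (\<Sum>i<n. x i * c i)}" (is "AE y in M. y \<in> ?H")
      by (rule AE_mp) (auto intro!: AE_I2 simp: f_def space_M right_diff_distrib sum_subtractf)
    have "?H = {y \<in> space M. (\<Sum>i<n. x i * y i) = (\<Sum>i<n. x i * c i)}" by (simp add: space_M)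
    also have "\<dots> \<in> events"
      by (intro borel_measurable_eq borel_measurable_sum borel_measurable_times borel_measurable_const measurable_coordinate) auto
    finally have "prob ?H = 1" using ae by (simp add: prob_eq_1)
    moreover have "prob ?H < 1"
      by (rule hyp) (use that in \<open>auto simp: Rn_hyperplane_def\<close>)
    ultimately show False by simp
  qed
  have "\<exists>a. \<forall>j<n. a j j \<noteq> 0 \<and> (\<forall>i>j. a j i = 0) \<and> (\<forall>k<n. Q (a j) (a k) = (if j = k then 1 else 0))"
    by (rule gram_schmidt_triangular[OF sym lin pos])
  then obtain a where a: "\<forall>j<n. a j j \<noteq> 0 \<and> (\<forall>i>j. a j i = 0) \<and>
      (\<forall>k<n. Q (a j) (a k) = (if j = k then 1 else 0))"
    by (elim exE)
  have orth: "Q (a j) (a k) = (if j = k then 1 else 0)" if "j < n" "k < n" for j k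
    using a that by blast
  define T where "T = (\<lambda>y. \<lambda>j\<in>{..<n}. f (a j) y)"
  let ?D = "distr M (Pi\<^sub>M {..<n} (\<lambda>_. borel)) T"
  have T: "T \<in> measurable M (Pi\<^sub>M {..<n} (\<lambda>_. borel))"
    unfolding T_def using aff by (intro measurable_restrict) (simp add: affine_functional_def)
  have "T (Rn_lincomb n l x (1 - l) y) = Rn_lincomb n l (T x) (1 - l) (T y)" for l x y
    using aff unfolding T_def affine_functional_def by (auto simp: Rn_lincomb_def restrict_def)
  then interpret D: log_concave_space ?D n by (rule affine_transform_space[OF T])
  have "isotropic_space ?D n"
  proof unfold_locales
    fix i assume i: "i < n"
    have "D.expectation (\<lambda>y. y i) = expectation (\<lambda>y. T y i)"
      using i by (intro integral_distr[OF T]) (auto intro: measurable_component_singleton)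
    also have "\<dots> = expectation (f (a i))" using i by (simp add: T_def)
    also have "\<dots> = (\<Sum>k<n. a i k * (expectation (\<lambda>y. y k) - c k))"
      unfolding f_def using integrable_affine[OF affine_coordinate]
      by (subst Bochner_Integration.integral_sum) (auto simp: prob_space)
    finally show "D.expectation (\<lambda>y. y i) = 0" by (simp add: c_def)
  next
    fix i j assume ij: "i < n" "j < n"
    have "D.expectation (\<lambda>y. y i * y j) = expectation (\<lambda>y. T y i * T y j)"
      using ij by (intro integral_distr[OF T] borel_measurable_times) (auto intro: measurable_component_singleton)
    then show "D.expectation (\<lambda>y. y i * y j) = (if i = j then 1 else 0)"
      using ij orth[of i j] by (simp add: T_def Q_def)
  qed
  moreover have "\<forall>j<n. a j j \<noteq> 0 \<and> (\<forall>i>j. a j i = 0)" using a by blast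
  ultimately show ?thesis using T unfolding T_def f_def by blast
qed

end

section \<open>Massive cubes\<close>

definition Rn_cube :: "nat \<Rightarrow> real \<Rightarrow> (nat \<Rightarrow> real) \<Rightarrow> (nat \<Rightarrow> real) set" where
  "Rn_cube n s w = {y \<in> Rn n. \<forall>i<n. w i \<le> y i \<and> y i \<le> w i + s}"

lemma sum_abs_le_max:
  fixes \<theta> d :: "nat \<Rightarrow> real"
  assumes "\<And>i. i < n \<Longrightarrow> \<bar>\<theta> i\<bar> \<le> T" "\<And>i. i < n \<Longrightarrow> \<bar>d i\<bar> \<le> s"
  shows "(\<Sum>i<n. \<theta> i * d i) \<le> real n * (T * s)"
proof -
  have "\<theta> i * d i \<le> T * s" if "i < n" for i
  proof -
    have "\<theta> i * d i \<le> \<bar>\<theta> i\<bar> * \<bar>d i\<bar>" by (metis abs_ge_self abs_mult)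
    also have "\<dots> \<le> T * s" using assms[OF that] by (intro mult_mono) auto
    finally show ?thesis .
  qed
  then have "(\<Sum>i<n. \<theta> i * d i) \<le> (\<Sum>i<n. T * s)" by (intro sum_mono) auto
  then show ?thesis by simp
qed

context log_concave_space begin

lemma sets_Rn_cube [measurable]: "Rn_cube n s w \<in> events"
proof -
  have "Rn_cube n s w = {y \<in> space M. \<forall>i\<in>{..<n}. w i \<le> y i \<and> y i \<le> w i + s}"
    by (simp add: Rn_cube_def space_M Ball_def)
  also have "\<dots> \<in> events"
    by (intro sets.sets_Collect_finite_All sets.sets_Collect_conj borel_measurable_le
        borel_measurable_const measurable_coordinate) auto
  finally show ?thesis .
qed

text \<open>A convex combination of two translates of a cube lies in the translate at the combined
  corner. Hence the mass of the cube at \<open>w\<close> is log-concave in \<open>w\<close>, and its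
  superlevel sets are convex.\<close>

lemma convex_massive_cubes:
  assumes "0 < \<delta>"
  shows "Rn_convex n {w \<in> Rn n. \<delta> \<le> prob (Rn_cube n s w)}"
  unfolding Rn_convex_def
proof (intro conjI ballI allI impI)
  fix x y and u v :: real
  assume x: "x \<in> {w \<in> Rn n. \<delta> \<le> prob (Rn_cube n s w)}" and y: "y \<in> {w \<in> Rn n. \<delta> \<le> prob (Rn_cube n s w)}"
    and uv: "0 \<le> u" "0 \<le> v" "u + v = 1"
  have v: "v = 1 - u" using uv by simp
  have "\<delta> \<le> prob (Rn_cube n s (Rn_lincomb n u x v y))"
  proof (cases "u = 0 \<or> u = 1")
    case True
    moreover have "restrict x {..<n} = x" "restrict y {..<n} = y"
      using x y by (simp_all add: Rn_def PiE_iff extensional_restrict)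
    ultimately have "Rn_lincomb n u x v y = x \<or> Rn_lincomb n u x v y = y"
      unfolding v by (elim disjE) (simp_all add: Rn_lincomb_def)
    then show ?thesis using x y by auto
  next
    case False
    then have u: "0 < u" "u < 1" using uv by auto
    have "\<delta> = \<delta> powr u * \<delta> powr (1 - u)"
      using assms by (simp add: powr_add[symmetric])
    also have "\<dots> \<le> prob (Rn_cube n s x) powr u * prob (Rn_cube n s y) powr (1 - u)"
      using x y u assms by (intro mult_mono powr_mono2) auto
    also have "\<dots> \<le> prob (Rn_cube n s (Rn_lincomb n u x v y))"
    proof (rule log_concave[OF _ _ _ u])
      fix a b assume a: "a \<in> Rn_cube n s x" and b: "b \<in> Rn_cube n s y"
      have "u * x i + v * y i \<le> u * a i + v * b i \<and> u * a i + v * b i \<le> u * x i + v * y i + s" if "i < n" for i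
      proof -
        have "u * x i \<le> u * a i" "v * y i \<le> v * b i" "u * a i \<le> u * (x i + s)" "v * b i \<le> v * (y i + s)"
          using a b that uv by (auto simp: Rn_cube_def intro!: mult_left_mono)
        moreover have "u * s + v * s = s" using uv by (metis distrib_right mult_1)
        ultimately show ?thesis by (simp add: algebra_simps)
      qed
      then show "Rn_lincomb n u a (1 - u) b \<in> Rn_cube n s (Rn_lincomb n u x v y)"
        unfolding v by (simp add: Rn_cube_def Rn_lincomb_in_Rn) (simp add: Rn_lincomb_def)
    qed measurable
    finally show ?thesis .
  qed
  then show "Rn_lincomb n u x v y \<in> {w \<in> Rn n. \<delta> \<le> prob (Rn_cube n s w)}"
    by (simp add: Rn_lincomb_in_Rn)
qed auto

end

context isotropic_space begin

text \<open>For \<open>Z = \<langle>\<theta>, y\<rangle>\<close> the mean is 0, so \<open>E\<bar>Z\<bar> = 2 E Z\<^sup>+\<close>. If \<open>Z\<close> were rarely above \<open>1/100\<close>, this would be small,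
  and by \<open>affine_second_moment\<close> the second moment would be less than 1.\<close>

lemma direction_mass:
  assumes \<theta>: "(\<Sum>i<n. (\<theta> i)\<^sup>2) = 1"
  shows "1 / 2500 \<le> prob {y \<in> space M. 1 / 100 < (\<Sum>i<n. \<theta> i * y i)}"
proof (rule ccontr)
  define Z where "Z = (\<lambda>y. \<Sum>i<n. \<theta> i * y i)"
  define A where "A = {y \<in> space M. 1 / 100 < Z y}"
  assume "\<not> 1 / 2500 \<le> prob {y \<in> space M. 1 / 100 < (\<Sum>i<n. \<theta> i * y i)}"
  then have small: "prob A < 1 / 2500" by (simp add: A_def Z_def)
  have aff: "affine_functional Z"
    using affine_functional_sum[of \<theta> "\<lambda>_. 0"] by (simp add: Z_def)
  have [measurable]: "Z \<in> borel_measurable M" using aff by (simp add: affine_functional_def)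
  have [measurable]: "A \<in> events" unfolding A_def by measurable
  have intZ: "integrable M Z" and intZ2: "integrable M (\<lambda>y. (Z y)\<^sup>2)"
    using integrable_affine[OF aff] affine_square_integrable[OF aff] .
  have EZ: "expectation Z = 0"
    unfolding Z_def using mean_zero integrable_affine[OF affine_coordinate]
    by (subst Bochner_Integration.integral_sum) auto
  have EZ2: "expectation (\<lambda>y. (Z y)\<^sup>2) = 1"
  proof -
    have int: "integrable M (\<lambda>y. \<theta> i * \<theta> j * (y i * y j))" if "i < n" "j < n" for i j
      using integrable_affine_mult[OF affine_coordinate affine_coordinate] that by simp
    have "(\<lambda>y. (Z y)\<^sup>2) = (\<lambda>y. \<Sum>i<n. \<Sum>j<n. \<theta> i * \<theta> j * (y i * y j))"
      by (simp add: Z_def power2_eq_square sum_product algebra_simps)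
    then have "expectation (\<lambda>y. (Z y)\<^sup>2) = (\<Sum>i<n. \<Sum>j<n. \<theta> i * \<theta> j * expectation (\<lambda>y. y i * y j))"
    proof -
      have "expectation (\<lambda>y. \<Sum>i<n. \<Sum>j<n. \<theta> i * \<theta> j * (y i * y j))
          = (\<Sum>i<n. expectation (\<lambda>y. \<Sum>j<n. \<theta> i * \<theta> j * (y i * y j)))"
        by (intro Bochner_Integration.integral_sum Bochner_Integration.integrable_sum int) auto
      also have "\<dots> = (\<Sum>i<n. \<Sum>j<n. expectation (\<lambda>y. \<theta> i * \<theta> j * (y i * y j)))"
        by (intro sum.cong refl Bochner_Integration.integral_sum int) auto
      finally show ?thesis by (simp add: \<open>(\<lambda>y. (Z y)\<^sup>2) = _\<close>)
    qed
    also have "\<dots> = (\<Sum>i<n. \<Sum>j<n. if i = j then (\<theta> i)\<^sup>2 else 0)"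
      using covariance_id by (intro sum.cong) (auto simp: power2_eq_square)
    finally show ?thesis using \<theta> by simp
  qed
  \<comment> \<open>Off \<open>A\<close>, \<open>\<bar>Z\<bar> + Z\<close> is at most 2/100. On
    \<open>A\<close> it is \<open>2 Z\<close>, which is at most \<open>Z^2/50 + 50\<close> by the
    arithmetic-geometric mean inequality. The expectations then give
    \<open>1/50 + 1/50 + 50 * prob A\<close>, below 6/100.\<close>
  have pw: "\<bar>Z y\<bar> \<le> - Z y + (1 / 50 + 1 / 50 * (Z y)\<^sup>2 + 50 * indicator A y)" if "y \<in> space M" for y
  proof (cases "y \<in> A")
    case True
    have "0 \<le> (Z y / 10 - 5)\<^sup>2" by simp
    then show ?thesis using True by (auto simp: A_def power2_eq_square algebra_simps)
  next
    case False
    then have "Z y \<le> 1 / 100" using that by (simp add: A_def)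
    moreover have "0 \<le> (Z y)\<^sup>2" "indicator A y = (0 :: real)" using False by simp_all
    ultimately show ?thesis by linarith
  qed
  have intA: "integrable M (indicator A :: _ \<Rightarrow> real)"
    by (intro integrable_real_indicator) (auto simp: less_top[symmetric])
  have int: "integrable M (\<lambda>y. 1 / 50 + 1 / 50 * (Z y)\<^sup>2 + 50 * indicator A y :: real)"
    by (intro Bochner_Integration.integrable_add integrable_mult_right intZ2 intA) auto
  have "expectation (\<lambda>y. \<bar>Z y\<bar>) \<le> expectation (\<lambda>y. - Z y + (1 / 50 + 1 / 50 * (Z y)\<^sup>2 + 50 * indicator A y))"
    using intZ by (intro integral_mono pw Bochner_Integration.integrable_add[OF _ int]) auto
  also have "\<dots> = 1 / 25 + 50 * prob A"
    using intZ intZ2 intA EZ EZ2 by (simp add: prob_space)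
  also have "\<dots> \<le> 6 / 100" using small by simp
  finally have EA: "expectation (\<lambda>y. \<bar>Z y\<bar>) \<le> 6 / 100" .
  \<comment> \<open>The level 24/100 is four times the bound on the first absolute moment, so Markov
    gives the tail 1/4; and \<open>11 * (24/100)^2\<close> is about 0.63, below the variance
    1.\<close>
  have "prob {y \<in> space M. 24 / 100 < \<bar>Z y\<bar>} \<le> prob {y \<in> space M. 24 / 100 \<le> \<bar>Z y\<bar>}"
    by (intro finite_measure_mono) auto
  also have "\<dots> \<le> expectation (\<lambda>y. \<bar>Z y\<bar>) / (24 / 100)"
    using intZ by (intro integral_Markov_inequality_measure[where A = "space M"]) auto
  also have "\<dots> \<le> 1 / 4" using EA by simp
  finally have "expectation (\<lambda>y. (Z y)\<^sup>2) \<le> 11 * (24 / 100)\<^sup>2"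
    by (intro affine_second_moment(2)[OF aff]) auto
  then show False unfolding EZ2 by (simp add: power2_eq_square)
qed

text \<open>Chebyshev for each coordinate, of variance 1, and a union bound: \<open>n\<close> events
  of probability at most \<open>1/n^2\<close>.\<close>

lemma box_mass:
  assumes "n \<ge> 1"
  shows "1 - 1 / real n \<le> prob {y \<in> Rn n. \<forall>i<n. \<bar>y i\<bar> \<le> real n}"
proof -
  let ?B = "\<Union>i<n. {y \<in> space M. (real n)\<^sup>2 < (y i)\<^sup>2}"
  have m: "{y \<in> space M. (real n)\<^sup>2 < (y i)\<^sup>2} \<in> events" if "i < n" for i
    using measurable_coordinate[OF that] by measurable
  have "prob {y \<in> space M. (real n)\<^sup>2 < (y i)\<^sup>2} \<le> 1 / (real n)\<^sup>2" if i: "i < n" for i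
  proof -
    have [measurable]: "(\<lambda>y. y i) \<in> borel_measurable M" by (rule measurable_coordinate[OF i])
    have "prob {y \<in> space M. (real n)\<^sup>2 < (y i)\<^sup>2} \<le> prob {y \<in> space M. (real n)\<^sup>2 \<le> (y i)\<^sup>2}"
      by (intro finite_measure_mono) auto
    also have "\<dots> \<le> expectation (\<lambda>y. (y i)\<^sup>2) / (real n)\<^sup>2"
      using affine_square_integrable[OF affine_coordinate[OF i]] assms
      by (intro integral_Markov_inequality_measure[where A = "space M"]) auto
    also have "expectation (\<lambda>y. (y i)\<^sup>2) = 1"
      using covariance_id[OF i i] by (simp add: power2_eq_square)
    finally show ?thesis .
  qed
  then have "(\<Sum>i<n. prob {y \<in> space M. (real n)\<^sup>2 < (y i)\<^sup>2}) \<le> (\<Sum>i<n. 1 / (real n)\<^sup>2)"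
    by (intro sum_mono) auto
  moreover have "prob ?B \<le> (\<Sum>i<n. prob {y \<in> space M. (real n)\<^sup>2 < (y i)\<^sup>2})"
    using m by (intro measure_UNION_le) auto
  moreover have "(\<Sum>i<n. 1 / (real n)\<^sup>2) = 1 / real n"
    by (simp add: power2_eq_square)
  ultimately have "prob ?B \<le> 1 / real n" by simp
  moreover have "?B \<in> events" using m by (intro sets.finite_UN) auto
  moreover have "(real n)\<^sup>2 < u\<^sup>2 \<longleftrightarrow> \<not> \<bar>u\<bar> \<le> real n" for u :: real
    using abs_le_square_iff[of u "real n"] by (simp add: not_le)
  then have "space M - ?B = {y \<in> Rn n. \<forall>i<n. \<bar>y i\<bar> \<le> real n}"
    by (auto simp: space_M)
  ultimately show ?thesis using prob_compl[of ?B] by simp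
qed

lemma massive_cubes:
  assumes n: "n \<ge> 1" and s: "0 < s" and m: "real m * s = real n"
  defines "\<delta> \<equiv> 1 / ((2 * real m) ^ n * real n)"
  shows "\<exists>F. finite F \<and> F \<subseteq> {w \<in> Rn n. \<delta> \<le> prob (Rn_cube n s w)} \<and>
    1 - 2 / real n \<le> prob (\<Union>f\<in>F. Rn_cube n s f)"
proof -
  have mpos: "m > 0" using m n by (cases m) auto
  define I where "I = ({..<n} \<rightarrow>\<^sub>E {..<2 * m})"
  define c where "c = (\<lambda>k. \<lambda>i\<in>{..<n}. s * real (k i) - real n)"
  have fI: "finite I" and cI: "card I = (2 * m) ^ n"
    unfolding I_def by (auto intro: finite_PiE simp: card_PiE)
  define G where "G = {k \<in> I. \<delta> \<le> prob (Rn_cube n s (c k))}"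
  have cR: "c k \<in> Rn n" for k by (simp add: c_def Rn_def)
  have cover: "{y \<in> Rn n. \<forall>i<n. \<bar>y i\<bar> \<le> real n} \<subseteq> (\<Union>k\<in>I. Rn_cube n s (c k))"
  proof
    fix y assume y: "y \<in> {y \<in> Rn n. \<forall>i<n. \<bar>y i\<bar> \<le> real n}"
    have "\<exists>k<2 * m. s * real k - real n \<le> y i \<and> y i \<le> s * real k - real n + s" if i: "i < n" for i
    proof (cases "y i = real n")
      \<comment> \<open>At the right end of the box the floor would be \<open>2 * m\<close>, one too
        large; the last cube is closed and takes this endpoint.\<close>
      case True
      have "s * real (2 * m - 1) - real n + s = real n"
        using mpos m by (simp add: of_nat_diff algebra_simps)
      then show ?thesis using True mpos s by (intro exI[of _ "2 * m - 1"]) auto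
    next
      case False
      define u where "u = (y i + real n) / s"
      have yi: "- real n \<le> y i" "y i < real n" using y i False by (auto simp: abs_le_iff less_le)
      have u: "0 \<le> u" using yi s by (simp add: u_def)
      have "y i + real n < 2 * real m * s" using yi m by simp
      then have "u < 2 * real m" using s by (simp add: u_def pos_divide_less_eq)
      then have "nat \<lfloor>u\<rfloor> < 2 * m" using u by (simp add: nat_less_iff floor_less_iff)
      moreover have "real (nat \<lfloor>u\<rfloor>) \<le> u" "u \<le> real (nat \<lfloor>u\<rfloor>) + 1" using u by (auto simp: of_nat_nat)
      then have "s * real (nat \<lfloor>u\<rfloor>) \<le> s * u" "s * u \<le> s * (real (nat \<lfloor>u\<rfloor>) + 1)"
        using s by (auto intro!: mult_left_mono)
      moreover have "s * u = y i + real n" using s by (simp add: u_def)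
      ultimately show ?thesis by (intro exI[of _ "nat \<lfloor>u\<rfloor>"]) (simp add: algebra_simps)
    qed
    then obtain k where k: "\<And>i. i < n \<Longrightarrow> k i < 2 * m \<and> s * real (k i) - real n \<le> y i \<and> y i \<le> s * real (k i) - real n + s"
      by metis
    then have "restrict k {..<n} \<in> I" "y \<in> Rn_cube n s (c (restrict k {..<n}))"
      using y by (auto simp: I_def Rn_cube_def c_def)
    then show "y \<in> (\<Union>k\<in>I. Rn_cube n s (c k))" by blast
  qed
  have "prob (\<Union>k\<in>I - G. Rn_cube n s (c k)) \<le> (\<Sum>k\<in>I - G. prob (Rn_cube n s (c k)))"
    using fI by (intro measure_UNION_le) auto
  also have "\<dots> \<le> (\<Sum>k\<in>I - G. \<delta>)"
    by (intro sum_mono) (auto simp: G_def)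
  also have "\<dots> \<le> real (card I) * \<delta>"
  proof -
    have "real (card (I - G)) \<le> real (card I)" using fI by (simp add: card_mono)
    moreover have "0 \<le> \<delta>" by (simp add: \<delta>_def)
    ultimately show ?thesis by (simp add: mult_right_mono)
  qed
  also have "\<dots> = 1 / real n"
    using mpos n by (simp add: cI \<delta>_def)
  finally have bad: "prob (\<Union>k\<in>I - G. Rn_cube n s (c k)) \<le> 1 / real n" .
  have cover': "{y \<in> Rn n. \<forall>i<n. \<bar>y i\<bar> \<le> real n}
      \<subseteq> (\<Union>k\<in>G. Rn_cube n s (c k)) \<union> (\<Union>k\<in>I - G. Rn_cube n s (c k))"
    using cover by blast
  have fG: "finite G" using fI by (simp add: G_def)
  have "1 - 1 / real n \<le> prob {y \<in> Rn n. \<forall>i<n. \<bar>y i\<bar> \<le> real n}"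
    by (rule box_mass[OF n])
  also have "\<dots> \<le> prob ((\<Union>k\<in>G. Rn_cube n s (c k)) \<union> (\<Union>k\<in>I - G. Rn_cube n s (c k)))"
    using cover' fI fG by (intro finite_measure_mono sets.Un sets.finite_UN) auto
  also have "\<dots> \<le> prob (\<Union>k\<in>G. Rn_cube n s (c k)) + prob (\<Union>k\<in>I - G. Rn_cube n s (c k))"
    using fI fG by (intro measure_Un_le sets.finite_UN) auto
  finally have "1 - 2 / real n \<le> prob (\<Union>k\<in>G. Rn_cube n s (c k))"
    using bad by simp
  then show ?thesis
    using fI cR by (intro exI[of _ "c ` G"]) (auto simp: G_def)
qed

text \<open>A unit direction separating \<open>c\<close> from \<open>F\<close> would contradict \<open>direction_mass\<close>.\<close>

lemma central_cubes_massive: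
  assumes F: "finite F" "F \<subseteq> W" and W: "Rn_convex n W"
    and mass: "1 - 1 / 2500 < prob (\<Union>f\<in>F. Rn_cube n s f)"
    and c: "c \<in> Rn n" "\<And>i. i < n \<Longrightarrow> \<bar>c i\<bar> \<le> \<rho>" and s: "0 \<le> s"
    and small: "real n * \<rho> + real n * s \<le> 1 / 100"
  shows "c \<in> W"
proof -
  have "F \<noteq> {}" using mass by auto
  then consider w where "\<forall>f. 0 \<le> w f" "sum w F = 1" "\<forall>i<n. (\<Sum>f\<in>F. w f * (f i - c i)) = 0"
    | \<theta> where "\<forall>f\<in>F. 0 < (\<Sum>i<n. \<theta> i * (f i - c i))"
    using gordan_alternative[OF F(1), of n "\<lambda>f i. f i - c i"] by blast
  then show ?thesis
  proof cases
    case 1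
    have "(\<lambda>i\<in>{..<n}. \<Sum>f\<in>F. w f * f i) \<in> W"
      using 1 F W by (intro Rn_convex_sum) auto
    moreover have "(\<lambda>i\<in>{..<n}. \<Sum>f\<in>F. w f * f i) = c"
    proof
      fix i
      show "(\<lambda>i\<in>{..<n}. \<Sum>f\<in>F. w f * f i) i = c i"
      proof (cases "i < n")
        case True
        then have "0 = (\<Sum>f\<in>F. w f * f i) - (\<Sum>f\<in>F. w f) * c i"
          using 1(3) by (simp add: right_diff_distrib sum_subtractf sum_distrib_right)
        then show ?thesis using True 1(2) by simp
      qed (use c(1) in \<open>auto simp: Rn_def PiE_iff extensional_def\<close>)
    qed
    ultimately show ?thesis by simp
  next
    case 2
    define L where "L = sqrt (\<Sum>i<n. (\<theta> i)\<^sup>2)"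
    obtain f0 where "f0 \<in> F" using \<open>F \<noteq> {}\<close> by auto
    have "(\<Sum>i<n. (\<theta> i)\<^sup>2) \<noteq> 0"
    proof
      assume "(\<Sum>i<n. (\<theta> i)\<^sup>2) = 0"
      then have "\<forall>i<n. \<theta> i = 0" by (subst (asm) sum_nonneg_eq_0_iff) auto
      then show False using 2 \<open>f0 \<in> F\<close> by fastforce
    qed
    moreover have "0 \<le> (\<Sum>i<n. (\<theta> i)\<^sup>2)" by (intro sum_nonneg) auto
    ultimately have L: "L > 0" "L\<^sup>2 = (\<Sum>i<n. (\<theta> i)\<^sup>2)" by (simp_all add: L_def)
    define \<eta> where "\<eta> = (\<lambda>i. - \<theta> i / L)"
    have \<eta>: "(\<Sum>i<n. (\<eta> i)\<^sup>2) = 1"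
      using L(1) by (simp add: \<eta>_def power_divide sum_divide_distrib[symmetric] L(2)[symmetric])
    have \<eta>1: "\<bar>\<eta> i\<bar> \<le> 1" if "i < n" for i
    proof -
      have "(\<eta> i)\<^sup>2 \<le> (\<Sum>i<n. (\<eta> i)\<^sup>2)" using that by (intro member_le_sum) auto
      then show ?thesis using \<eta> by (simp add: abs_square_le_1)
    qed
    let ?G = "\<Union>f\<in>F. Rn_cube n s f"
    have G: "?G \<in> events" using F by (intro sets.finite_UN) auto
    \<comment> \<open>The functional \<eta> points away from \<open>F\<close>: for \<open>y\<close>
      in the cube at \<open>f\<close>, split \<open>y\<close> as
      \<open>(f - c) + c + (y - f)\<close>. The first part contributes less than 0, the other two at
      most \<open>n * \<rho>\<close> and \<open>n * s\<close>. So a half-space of mass at least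
      1/2500 misses all the cubes.\<close>
    have "{y \<in> space M. 1 / 100 < (\<Sum>i<n. \<eta> i * y i)} \<subseteq> space M - ?G"
    proof clarify
      fix y f assume y: "1 / 100 < (\<Sum>i<n. \<eta> i * y i)" "f \<in> F" "y \<in> Rn_cube n s f"
      have "(\<Sum>i<n. \<eta> i * (f i - c i)) = - (\<Sum>i<n. \<theta> i * (f i - c i)) / L"
        by (simp add: \<eta>_def sum_divide_distrib sum_negf[symmetric])
      also have "\<dots> < 0" using 2 y L by (simp add: divide_neg_pos)
      finally have "(\<Sum>i<n. \<eta> i * (f i - c i)) < 0" .
      moreover have "(\<Sum>i<n. \<eta> i * c i) \<le> real n * (1 * \<rho>)"
        using \<eta>1 c by (intro sum_abs_le_max) auto
      moreover have "(\<Sum>i<n. \<eta> i * (y i - f i)) \<le> real n * (1 * s)"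
        using \<eta>1 y by (intro sum_abs_le_max) (auto simp: Rn_cube_def abs_le_iff intro: order_trans)
      moreover have "(\<Sum>i<n. \<eta> i * y i) =
          (\<Sum>i<n. \<eta> i * (f i - c i)) + (\<Sum>i<n. \<eta> i * c i) + (\<Sum>i<n. \<eta> i * (y i - f i))"
        by (simp add: sum.distrib[symmetric] algebra_simps)
      ultimately show False using y(1) small by simp
    qed
    then have "prob {y \<in> space M. 1 / 100 < (\<Sum>i<n. \<eta> i * y i)} \<le> prob (space M - ?G)"
      using G by (intro finite_measure_mono) auto
    also have "\<dots> < 1 / 2500" using prob_compl[OF G] mass by simp
    finally show ?thesis using direction_mass[OF \<eta>] by simp
  qed
qed

end

text \<open>The box \<open>[-n,n]\<^sup>n\<close> consists of \<open>(400 n\<^sup>5)\<^sup>n\<close> cubes of side \<open>1/(200 n\<^sup>4)\<close>. Those of mass below this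
  threshold have total mass at most \<open>1/n\<close>.\<close>

definition cube_mass :: "nat \<Rightarrow> real" where
  "cube_mass n = 1 / ((400 * real n ^ 5) ^ n * real n)"

section \<open>Surrounding points by massive cubes, and transfer to the original measure\<close>

lemma cube_mass_le_1:
  assumes "n \<ge> 1"
  shows "cube_mass n \<le> 1"
proof -
  have "1 \<le> real n ^ 5" using assms by (intro one_le_power) auto
  then have "1 \<le> (400 * real n ^ 5) ^ n" by (intro one_le_power) simp
  then have "1 * 1 \<le> (400 * real n ^ 5) ^ n * real n"
    using assms by (intro mult_mono) auto
  then show ?thesis by (simp add: cube_mass_def divide_le_eq)
qed

text \<open>For given \<theta>, take the coordinate \<open>k\<close> where
  \<open>\<bar>\<theta> k\<bar>\<close> is largest and the sign that lowers the functional. The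
  shift by \<open>r\<close> gains \<open>\<bar>\<theta> k\<bar> * r\<close>, while the freedom
  inside the cubes costs at most \<open>n * \<bar>\<theta> k\<bar> * s\<close>.\<close>

lemma cube_transversal_cover:
  assumes n: "n \<ge> 1" and s: "0 \<le> s" "real n * s \<le> r" and x: "x \<in> Rn_cube n s z"
  shows "transversal_cover n ({..<n} \<times> {-1, 1})
    (\<lambda>(k, \<sigma>). Rn_cube n s (\<lambda>i\<in>{..<n}. z i + (if i = k then \<sigma> * r else 0))) x"
  unfolding transversal_cover_def
proof (intro allI impI)
  fix p :: "nat \<times> real \<Rightarrow> nat \<Rightarrow> real" and \<theta> :: "nat \<Rightarrow> real"
  assume "\<forall>j\<in>{..<n} \<times> {- 1, 1}. p j \<in> (case j of (k, \<sigma>) \<Rightarrow>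
      Rn_cube n s (\<lambda>i\<in>{..<n}. z i + (if i = k then \<sigma> * r else 0)))"
  then have p: "p (k, \<sigma>) \<in> Rn_cube n s (\<lambda>i\<in>{..<n}. z i + (if i = k then \<sigma> * r else 0))"
    if "k < n" "\<sigma> \<in> {-1, 1}" for k \<sigma>
    using that by fastforce
  have ne: "(\<lambda>i. \<bar>\<theta> i\<bar>) ` {..<n} \<noteq> {}" using n by (auto simp: lessThan_empty_iff)
  have "Max ((\<lambda>i. \<bar>\<theta> i\<bar>) ` {..<n}) \<in> (\<lambda>i. \<bar>\<theta> i\<bar>) ` {..<n}" by (intro Max_in ne) auto
  then obtain k where k1: "k < n" "Max ((\<lambda>i. \<bar>\<theta> i\<bar>) ` {..<n}) = \<bar>\<theta> k\<bar>" by auto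
  have k: "k < n" "\<And>i. i < n \<Longrightarrow> \<bar>\<theta> i\<bar> \<le> \<bar>\<theta> k\<bar>"
    unfolding k1(2)[symmetric] using k1(1) by auto
  define \<sigma> :: real where "\<sigma> = (if \<theta> k < 0 then 1 else -1)"
  have \<sigma>: "\<sigma> \<in> {-1, 1}" "\<theta> k * \<sigma> = - \<bar>\<theta> k\<bar>" by (auto simp: \<sigma>_def)
  define d where "d = (\<lambda>i. p (k, \<sigma>) i - x i - (if i = k then \<sigma> * r else 0))"
  have "\<bar>d i\<bar> \<le> s" if "i < n" for i
    using p[OF k(1) \<sigma>(1)] x that by (auto simp: Rn_cube_def d_def abs_le_iff dest!: spec[of _ i])
  then have "(\<Sum>i<n. \<theta> i * d i) \<le> real n * (\<bar>\<theta> k\<bar> * s)"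
    using k by (intro sum_abs_le_max) auto
  also have "\<dots> \<le> \<bar>\<theta> k\<bar> * r"
    using mult_left_mono[OF s(2), of "\<bar>\<theta> k\<bar>"] by (simp add: algebra_simps)
  finally have "(\<Sum>i<n. \<theta> i * d i) \<le> \<bar>\<theta> k\<bar> * r" .
  moreover have "(\<Sum>i<n. \<theta> i * (if i = k then \<sigma> * r else 0)) = \<theta> k * \<sigma> * r"
  proof -
    have "(\<Sum>i<n. \<theta> i * (if i = k then \<sigma> * r else 0)) = (\<Sum>i<n. if i = k then \<theta> k * \<sigma> * r else 0)"
      by (intro sum.cong) auto
    then show ?thesis using k(1) by simp
  qed
  moreover have "(\<Sum>i<n. \<theta> i * p (k, \<sigma>) i) = (\<Sum>i<n. \<theta> i * x i) + (\<Sum>i<n. \<theta> i * d i)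
      + (\<Sum>i<n. \<theta> i * (if i = k then \<sigma> * r else 0))"
    unfolding d_def by (simp add: sum.distrib[symmetric] distrib_left[symmetric])
  ultimately have "(\<Sum>i<n. \<theta> i * p (k, \<sigma>) i) \<le> (\<Sum>i<n. \<theta> i * x i)"
    using \<sigma>(2) by simp
  then show "\<exists>j\<in>{..<n} \<times> {- 1, 1}. (\<Sum>i<n. \<theta> i * p j i) \<le> (\<Sum>i<n. \<theta> i * x i)"
    using k(1) \<sigma>(1) by blast
qed

lemma (in isotropic_space) transversal_cover_core:
  assumes n: "n \<ge> 5001"
  shows "\<exists>C\<in>events. (1 - 2 / real n) * cube_mass n powr (1 / (real n)\<^sup>2) \<le> prob C \<and>
    (\<forall>x\<in>C. \<exists>U. (\<forall>j\<in>{..<n} \<times> {-1, 1 :: real}. U j \<in> events \<and> cube_mass n \<le> prob (U j)) \<and>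
       transversal_cover n ({..<n} \<times> {-1, 1}) U x)"
proof -
  have n0: "real n > 0" "n \<ge> 1" using n by auto
  \<comment> \<open>Here \<open>n * \<rho> = 1/200\<close> spends half of the margin 1/100 of
    \<open>direction_mass\<close>; the other half covers the cube term
    \<open>n * s = t * \<rho>\<close>.\<close>
  define s where "s = 1 / (200 * real n ^ 4)"
  define \<rho> where "\<rho> = 1 / (200 * real n)"
  define t where "t = 1 / (real n)\<^sup>2"
  define m where "m = 200 * n ^ 5"
  define \<delta> where "\<delta> = cube_mass n"
  define W where "W = {w \<in> Rn n. \<delta> \<le> prob (Rn_cube n s w)}"
  have s: "0 < s" using n0 by (simp add: s_def)
  have m: "real m * s = real n" using n0 by (simp add: m_def s_def power_eq_if)
  have \<delta>: "\<delta> = 1 / ((2 * real m) ^ n * real n)" by (simp add: \<delta>_def cube_mass_def m_def)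
  have \<delta>0: "0 < \<delta>" using n0 by (simp add: \<delta>_def cube_mass_def)
  have t: "0 < t" "t < 1" using n by (auto simp: t_def power2_eq_square divide_less_eq intro: less_1_mult)
  have ts: "real n * s = t * \<rho>" using n0 by (simp add: s_def t_def \<rho>_def power_eq_if power2_eq_square)
  obtain F where F: "finite F" "F \<subseteq> W" "1 - 2 / real n \<le> prob (\<Union>f\<in>F. Rn_cube n s f)"
    using massive_cubes[OF n0(2) s m] unfolding W_def \<delta> by blast
  have W: "Rn_convex n W" unfolding W_def by (rule convex_massive_cubes[OF \<delta>0])
  \<comment> \<open>The origin of the bound 5001: the lost mass has to stay below the half-space
    mass 1/2500.\<close>
  have "2 / real n < 1 / 2500" using n by (simp add: divide_less_eq)
  then have mass: "1 - 1 / 2500 < prob (\<Union>f\<in>F. Rn_cube n s f)" using F(3) by linarith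
  have center: "c \<in> W" if "c \<in> Rn n" "\<And>i. i < n \<Longrightarrow> \<bar>c i\<bar> \<le> \<rho>" for c
  proof (rule central_cubes_massive[OF F(1,2) W mass that])
    have "real n * \<rho> = 1 / 200" using n0 by (simp add: \<rho>_def)
    moreover have "t * \<rho> \<le> 1 * (1 / 200)"
      using t n0 n by (intro mult_mono) (auto simp: \<rho>_def divide_le_eq)
    ultimately show "real n * \<rho> + real n * s \<le> 1 / 100" unfolding ts by simp
  qed (use s in auto)
  \<comment> \<open>With \<open>Q\<close> the cube at the origin, \<open>(1-t) (f + Q) + t Q\<close>
    lies in \<open>(1-t) f + Q\<close>, so log-concavity compares \<open>C\<close> with the massive
    cubes and the central cube at \<open>z0\<close>.\<close>
  define C where "C = (\<Union>f\<in>F. Rn_cube n s (\<lambda>i\<in>{..<n}. (1 - t) * f i))"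
  have C: "C \<in> events" unfolding C_def using F by (intro sets.finite_UN) auto
  define z0 where "z0 = (\<lambda>i\<in>{..<n}. 0 :: real)"
  have "z0 \<in> W" using n0 by (intro center) (auto simp: z0_def Rn_def \<rho>_def)
  have "(1 - 2 / real n) * \<delta> powr t \<le> prob (\<Union>f\<in>F. Rn_cube n s f) powr (1 - t) * prob (Rn_cube n s z0) powr (1 - (1 - t))"
  proof (intro mult_mono)
    have "prob (\<Union>f\<in>F. Rn_cube n s f) powr 1 \<le> prob (\<Union>f\<in>F. Rn_cube n s f) powr (1 - t)"
      using t mass by (intro powr_mono') auto
    then show "1 - 2 / real n \<le> prob (\<Union>f\<in>F. Rn_cube n s f) powr (1 - t)" using F(3) mass by simp
    show "\<delta> powr t \<le> prob (Rn_cube n s z0) powr (1 - (1 - t))"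
      using \<open>z0 \<in> W\<close> \<delta>0 t by (auto simp: W_def intro!: powr_mono2)
  qed auto
  also have "\<dots> \<le> prob C"
  proof (rule log_concave)
    show "(\<Union>f\<in>F. Rn_cube n s f) \<in> events" using F by (intro sets.finite_UN) auto
    fix a b assume a: "a \<in> (\<Union>f\<in>F. Rn_cube n s f)" and b: "b \<in> Rn_cube n s z0"
    obtain f where f: "f \<in> F" "a \<in> Rn_cube n s f" using a by auto
    have "(1 - t) * f i \<le> (1 - t) * a i + t * b i \<and> (1 - t) * a i + t * b i \<le> (1 - t) * f i + s" if "i < n" for i
    proof -
      have "(1 - t) * f i \<le> (1 - t) * a i" "(1 - t) * a i \<le> (1 - t) * (f i + s)" "t * 0 \<le> t * b i" "t * b i \<le> t * s"
        using f b that t by (auto simp: Rn_cube_def z0_def intro!: mult_left_mono)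
      then show ?thesis by (simp add: algebra_simps)
    qed
    then have "Rn_lincomb n (1 - t) a (1 - (1 - t)) b \<in> Rn_cube n s (\<lambda>i\<in>{..<n}. (1 - t) * f i)"
      by (simp add: Rn_cube_def Rn_lincomb_in_Rn) (simp add: Rn_lincomb_def)
    then show "Rn_lincomb n (1 - t) a (1 - (1 - t)) b \<in> C"
      using f(1) unfolding C_def by blast
  qed (use t C in auto)
  finally have massC: "(1 - 2 / real n) * \<delta> powr t \<le> prob C" .
  have "\<exists>U. (\<forall>j\<in>{..<n} \<times> {-1, 1 :: real}. U j \<in> events \<and> \<delta> \<le> prob (U j)) \<and>
       transversal_cover n ({..<n} \<times> {-1, 1}) U x" if x: "x \<in> C" for x
  proof -
    obtain f where f: "f \<in> F" "x \<in> Rn_cube n s (\<lambda>i\<in>{..<n}. (1 - t) * f i)"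
      using x by (auto simp: C_def)
    define z where "z = (\<lambda>i\<in>{..<n}. (1 - t) * f i)"
    define U where "U = (\<lambda>(k, \<sigma>). Rn_cube n s (\<lambda>i\<in>{..<n}. z i + (if i = k then \<sigma> * (t * \<rho>) else 0)))"
    have "U j \<in> events \<and> \<delta> \<le> prob (U j)" if j: "j \<in> {..<n} \<times> {-1, 1 :: real}" for j
    proof -
      obtain k \<sigma> where [simp]: "j = (k, \<sigma>)" and \<sigma>: "\<sigma> \<in> {-1, 1}" using j by auto
      \<comment> \<open>The displaced corner is \<open>(1-t) f + t c\<close> with \<open>c\<close>
        the point \<open>\<sigma> \<rho>\<close> on axis \<open>k\<close>; both \<open>f\<close> and
        \<open>c\<close> lie in the convex set \<open>W\<close>.\<close>
      define c where "c = (\<lambda>i\<in>{..<n}. if i = k then \<sigma> * \<rho> else 0)"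
      have "c \<in> W" using \<sigma> n0 by (intro center) (auto simp: c_def Rn_def \<rho>_def)
      then have "Rn_lincomb n (1 - t) f t c \<in> W"
        using W F(2) f(1) t unfolding Rn_convex_def by force
      moreover have "Rn_lincomb n (1 - t) f t c = (\<lambda>i\<in>{..<n}. z i + (if i = k then \<sigma> * (t * \<rho>) else 0))"
        by (auto simp: Rn_lincomb_def z_def c_def)
      ultimately show ?thesis by (simp add: U_def W_def)
    qed
    moreover have "transversal_cover n ({..<n} \<times> {-1, 1}) U x"
      unfolding U_def using s ts f(2)[folded z_def] n0(2) by (intro cube_transversal_cover) auto
    ultimately show ?thesis by blast
  qed
  then show ?thesis using C massC unfolding \<delta>_def t_def by blast
qed

text \<open>By Gordan, covering \<open>T x\<close> yields convex weights for which the combination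
  of the \<open>T (p j) - T x\<close> vanishes. Triangularity removes the linear part of
  \<open>T\<close>, so the same weights annihilate the \<open>p j - x\<close>, and no \<theta> can
  be positive on all of these.\<close>

lemma transversal_cover_pullback:
  fixes n :: nat and a :: "nat \<Rightarrow> nat \<Rightarrow> real" and c :: "nat \<Rightarrow> real"
  defines "T \<equiv> (\<lambda>y. \<lambda>k\<in>{..<n}. \<Sum>i<n. a k i * (y i - c i))"
  assumes J: "finite J" "J \<noteq> {}"
    and a: "\<forall>k<n. a k k \<noteq> 0 \<and> (\<forall>i>k. a k i = 0)"
    and V: "transversal_cover n J V (T x)"
  shows "transversal_cover n J (\<lambda>j. T -` V j \<inter> S) x"
  unfolding transversal_cover_def
proof (intro allI impI)
  fix p :: "'a \<Rightarrow> nat \<Rightarrow> real" and \<theta> :: "nat \<Rightarrow> real"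
  assume "\<forall>j\<in>J. p j \<in> T -` V j \<inter> S"
  then have "\<forall>j\<in>J. T (p j) \<in> V j" by simp
  then have "\<exists>j\<in>J. (\<Sum>i<n. \<eta> i * T (p j) i) \<le> (\<Sum>i<n. \<eta> i * T x i)" for \<eta>
    using V[unfolded transversal_cover_def, THEN spec[of _ "\<lambda>j. T (p j)"]] by blast
  then have "\<exists>j\<in>J. \<not> 0 < (\<Sum>i<n. \<eta> i * (T (p j) i - T x i))" for \<eta>
    by (simp add: right_diff_distrib sum_subtractf not_less)
  then obtain w where w: "\<forall>j. 0 \<le> w j" "sum w J = 1" "\<forall>k<n. (\<Sum>j\<in>J. w j * (T (p j) k - T x k)) = 0"
    using gordan_alternative[OF J, of n "\<lambda>j i. T (p j) i - T x i"] by blast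
  have ker: "(\<Sum>i<n. a k i * (\<Sum>j\<in>J. w j * (p j i - x i))) = 0" if "k < n" for k
  proof -
    have "(\<Sum>i<n. a k i * (\<Sum>j\<in>J. w j * (p j i - x i))) = (\<Sum>j\<in>J. w j * (\<Sum>i<n. a k i * (p j i - x i)))"
      unfolding sum_distrib_left by (subst sum.swap) (simp add: mult.left_commute)
    also have "\<dots> = (\<Sum>j\<in>J. w j * (T (p j) k - T x k))"
      using that by (simp add: T_def sum_subtractf[symmetric] right_diff_distrib[symmetric])
    finally show ?thesis using w(3) that by simp
  qed
  have zero: "(\<Sum>j\<in>J. w j * (p j i - x i)) = 0" if "i < n" for i
    by (rule triangular_kernel_trivial[where a = a and n = n and d = "\<lambda>i. \<Sum>j\<in>J. w j * (p j i - x i)"])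
      (use a ker that in auto)
  show "\<exists>j\<in>J. (\<Sum>i<n. \<theta> i * p j i) \<le> (\<Sum>i<n. \<theta> i * x i)"
  proof (rule ccontr)
    assume "\<not> ?thesis"
    then have neg: "0 < (\<Sum>i<n. \<theta> i * (p j i - x i))" if "j \<in> J" for j
      using that by (simp add: right_diff_distrib sum_subtractf not_le)
    obtain j where "j \<in> J" "0 < w j"
    proof (rule ccontr)
      assume "\<not> thesis"
      then have "sum w J \<le> 0" using that by (intro sum_nonpos) force
      then show False using w(2) by simp
    qed
    then have "0 < (\<Sum>j\<in>J. w j * (\<Sum>i<n. \<theta> i * (p j i - x i)))"
      using w(1) neg J by (intro sum_pos2[of J j]) (auto simp: less_imp_le)
    also have "\<dots> = (\<Sum>i<n. \<theta> i * (\<Sum>j\<in>J. w j * (p j i - x i)))"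
      unfolding sum_distrib_left by (subst sum.swap) (simp add: mult.left_commute)
    also have "\<dots> = 0" using zero by simp
    finally show False by simp
  qed
qed

text \<open>Only the core and its covers are constructed in the isotropic image and pulled back; the
  random polytope is that of \<open>M\<close> throughout. The premise of the first claim keeps the
  factor in front of the mass of the core nonnegative.\<close>

lemma expected_polytope_measure_lower:
  assumes lc: "log_concave_prob n M" and n: "n \<ge> 5001" and N: "N > 0"
  shows "2 * real n * (1 - cube_mass n) ^ N \<le> 1 \<Longrightarrow>
      (1 - 2 * real n * (1 - cube_mass n) ^ N) * ((1 - 2 / real n) * cube_mass n powr (1 / (real n)\<^sup>2))
        \<le> expected_polytope_measure n N M"
    and "expected_polytope_measure n N M \<le> 1"
proof -
  interpret log_concave_space M n by (rule log_concave_prob_imp_space[OF lc])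
  let ?J = "{..<n} \<times> {-1, 1 :: real}"
  let ?B = "Pi\<^sub>M {..<n} (\<lambda>_. borel :: real measure)"
  have J: "finite ?J" "?J \<noteq> {}" using n by (auto simp: lessThan_empty_iff)
  have hyp: "prob H < 1" if "Rn_hyperplane n H" for H
    using lc that by (simp add: log_concave_prob_def)
  obtain a c where a: "\<forall>j<n. a j j \<noteq> (0::real) \<and> (\<forall>i>j. a j i = 0)"
    and T0: "(\<lambda>y. \<lambda>j\<in>{..<n}. \<Sum>i<n. a j i * (y i - c i)) \<in> measurable M ?B"
    and iso: "isotropic_space (distr M ?B (\<lambda>y. \<lambda>j\<in>{..<n}. \<Sum>i<n. a j i * (y i - c i))) n"
  proof -
    have "\<exists>a c. (\<forall>j<n. a j j \<noteq> (0::real) \<and> (\<forall>i>j. a j i = 0)) \<and>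
      (\<lambda>y. \<lambda>j\<in>{..<n}. \<Sum>i<n. a j i * (y i - c i)) \<in> measurable M ?B \<and>
      isotropic_space (distr M ?B (\<lambda>y. \<lambda>j\<in>{..<n}. \<Sum>i<n. a j i * (y i - c i))) n"
      by (rule isotropic_position) (rule hyp)
    then show ?thesis using that by (elim exE conjE)
  qed
  define T where "T = (\<lambda>y. \<lambda>j\<in>{..<n}. \<Sum>i<n. a j i * (y i - c i))"
  let ?D = "distr M ?B T"
  have T: "T \<in> measurable M ?B" using T0 by (simp add: T_def)
  interpret D: isotropic_space ?D n using iso by (simp add: T_def)
  obtain C where C: "C \<in> sets ?D" "(1 - 2 / real n) * cube_mass n powr (1 / (real n)\<^sup>2) \<le> D.prob C"
    and U: "\<forall>x\<in>C. \<exists>U. (\<forall>j\<in>?J. U j \<in> sets ?D \<and> cube_mass n \<le> D.prob (U j)) \<and> transversal_cover n ?J U x"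
    using D.transversal_cover_core[OF n] by (elim bexE conjE)
  have pre: "T -` A \<inter> space M \<in> events" "prob (T -` A \<inter> space M) = D.prob A" if "A \<in> sets ?D" for A
    using that measurable_sets[OF T] by (simp_all add: measure_distr[OF T])
  define \<delta> where "\<delta> = cube_mass n"
  have d: "0 \<le> \<delta>" "\<delta> \<le> 1"
    using cube_mass_le_1[of n] n by (simp_all add: \<delta>_def cube_mass_def)
  have trans: "\<exists>U. (\<forall>j\<in>?J. U j \<in> events \<and> \<delta> \<le> prob (U j)) \<and> transversal_cover n ?J U x"
    if x: "x \<in> T -` C \<inter> space M" for x
  proof -
    have "T x \<in> C" using x by simp
    then obtain V where V: "\<forall>j\<in>?J. V j \<in> sets ?D \<and> cube_mass n \<le> D.prob (V j)" "transversal_cover n ?J V (T x)"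
      using U by blast
    define U where "U = (\<lambda>j. T -` V j \<inter> space M)"
    have "transversal_cover n ?J U x"
      unfolding U_def T_def
      by (rule transversal_cover_pullback[OF J a V(2)[unfolded T_def]])
    moreover have "U j \<in> events \<and> \<delta> \<le> prob (U j)" if "j \<in> ?J" for j
      using bspec[OF V(1) that] pre[of "V j"] unfolding U_def \<delta>_def by simp
    ultimately show ?thesis by (intro exI[of _ U] conjI) blast+
  qed
  note E = expected_polytope_measure_ge[OF prob_space_axioms sets_M N pre(1)[OF C(1)] J(1) d trans]
  have card: "real (card ?J) = 2 * real n" by (simp add: card_cartesian_product)
  show "expected_polytope_measure n N M \<le> 1" by (rule E(2))
  assume le: "2 * real n * (1 - cube_mass n) ^ N \<le> 1"
  have "(1 - 2 * real n * (1 - \<delta>) ^ N) * D.prob C \<le> expected_polytope_measure n N M"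
    using E(1) pre(2)[OF C(1)] unfolding card by simp
  then show "(1 - 2 * real n * (1 - cube_mass n) ^ N) * ((1 - 2 / real n) * cube_mass n powr (1 / (real n)\<^sup>2))
      \<le> expected_polytope_measure n N M"
    using C(2) le unfolding \<delta>_def[symmetric] by (auto intro: order_trans[OF mult_left_mono])
qed

section \<open>The uniform measure on the cube\<close>

definition unif01 :: "real measure" where
  "unif01 = uniform_measure lborel {0..1}"

lemma sets_unif01 [simp, measurable_cong]: "sets unif01 = sets borel"
  by (simp add: unif01_def)

lemma space_unif01 [simp]: "space unif01 = UNIV"
  by (simp add: unif01_def)

lemma emeasure_unif01: "A \<in> sets borel \<Longrightarrow> emeasure unif01 A = emeasure lborel ({0..1} \<inter> A)"
  by (simp add: unif01_def divide_ennreal_def)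

lemma measure_unif01: "A \<in> sets borel \<Longrightarrow> A \<subseteq> {0..1} \<Longrightarrow> measure unif01 A = measure lborel A"
  by (simp add: measure_def emeasure_unif01 Int_absorb1)

interpretation unif01: prob_space unif01
  unfolding unif01_def by (intro prob_space_uniform_measure) auto

section \<open>Brunn-Minkowski and Prekopa-Leindler inequalities on the unit interval\<close>

lemma measure_lborel_affine_image:
  fixes K :: "real set"
  assumes "compact K" "0 < c"
  shows "measure lborel ((\<lambda>x. c * x + d) ` K) = c * measure lborel K"
proof -
  have "compact ((\<lambda>x. c * x + d) ` K)"
    using assms by (intro compact_continuous_image continuous_intros) auto
  then have "measure lborel ((\<lambda>x. c * x + d) ` K) = measure lebesgue ((\<lambda>x. c *\<^sub>R x + d) ` K)"
    by (simp add: measure_completion borel_compact)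
  also have "\<dots> = c * measure lebesgue K"
    using assms(2) by (subst measure_lebesgue_affine) auto
  finally show ?thesis using assms by (simp add: measure_completion borel_compact)
qed

text \<open>The translates \<open>l K + (1-l) min L\<close> and \<open>l max K + (1-l) L\<close> lie in the sum set and meet in one point.\<close>

lemma brunn_minkowski_compact_real:
  fixes K L C :: "real set"
  assumes K: "compact K" "K \<noteq> {}" and L: "compact L" "L \<noteq> {}"
    and C: "C \<in> sets borel" "C \<subseteq> {0..1}" and l: "0 < l" "l < 1"
    and comb: "\<And>x y. x \<in> K \<Longrightarrow> y \<in> L \<Longrightarrow> l * x + (1 - l) * y \<in> C"
  shows "l * measure lborel K + (1 - l) * measure lborel L \<le> measure lborel C"
proof -
  obtain a where a: "a \<in> K" "\<And>x. x \<in> K \<Longrightarrow> x \<le> a" using compact_attains_sup[OF K] by blast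
  obtain b where b: "b \<in> L" "\<And>y. y \<in> L \<Longrightarrow> b \<le> y" using compact_attains_inf[OF L] by blast
  define K' where "K' = (\<lambda>x. l * x + (1 - l) * b) ` K"
  define L' where "L' = (\<lambda>y. (1 - l) * y + l * a) ` L"
  have cK: "compact K'" and cL: "compact L'"
    unfolding K'_def L'_def using K L by (auto intro!: compact_continuous_image continuous_intros)
  have fin: "emeasure lborel S \<noteq> \<infinity>" if "compact S" for S :: "real set"
    using emeasure_compact_finite[OF that] by auto
  have mK: "measure lborel K' = l * measure lborel K" and mL: "measure lborel L' = (1 - l) * measure lborel L"
    unfolding K'_def L'_def using K L l by (auto intro: measure_lborel_affine_image)
  let ?p = "l * a + (1 - l) * b"
  have "K' \<inter> L' \<subseteq> {?p}"
  proof
    fix z assume z: "z \<in> K' \<inter> L'"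
    then have "z \<le> ?p" using a l by (auto simp: K'_def)
    moreover have "?p \<le> z" using z b l by (auto simp: L'_def)
    ultimately show "z \<in> {?p}" by simp
  qed
  then have "measure lborel (K' \<inter> L') = 0"
    by (metis measure_empty subset_singleton_iff measure_lborel_singleton)
  moreover have "measure lborel (K' \<union> L') = measure lborel K' + measure lborel L' - measure lborel (K' \<inter> L')"
    using cK cL fin by (intro measure_Un3) (auto simp: fmeasurable_def borel_compact less_top)
  moreover have "measure lborel (K' \<union> L') \<le> measure lborel C"
  proof (rule measure_mono_fmeasurable)
    show "K' \<union> L' \<subseteq> C" using comb a(1) b(1) by (auto simp: K'_def L'_def add.commute)
    show "K' \<union> L' \<in> sets lborel" using cK cL by (simp add: borel_compact sets.Un)
    have "emeasure lborel C \<le> emeasure lborel {0..1::real}" using C by (intro emeasure_mono) auto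
    then show "C \<in> fmeasurable lborel"
      using C by (auto simp: fmeasurable_def intro: le_less_trans)
  qed
  ultimately show ?thesis using mK mL by simp
qed

lemma brunn_minkowski_real:
  fixes A B C :: "real set"
  assumes A: "A \<in> sets borel" "A \<subseteq> {0..1}" "A \<noteq> {}" and B: "B \<in> sets borel" "B \<subseteq> {0..1}" "B \<noteq> {}"
    and C: "C \<in> sets borel" "C \<subseteq> {0..1}" and l: "0 < l" "l < 1"
    and comb: "\<And>x y. x \<in> A \<Longrightarrow> y \<in> B \<Longrightarrow> l * x + (1 - l) * y \<in> C"
  shows "l * measure unif01 A + (1 - l) * measure unif01 B \<le> measure unif01 C"
proof (rule field_le_epsilon)
  have inner: "\<exists>K\<subseteq>S. compact K \<and> K \<noteq> {} \<and> measure unif01 S - e \<le> measure unif01 K"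
    if S: "S \<in> sets borel" "S \<noteq> {}" and e: "0 < e" for S :: "real set" and e
  proof -
    obtain s where s: "s \<in> S" using S by auto
    show ?thesis
    proof (cases "measure unif01 S - e < 0")
      case True
      then show ?thesis using s by (intro exI[of _ "{s}"]) (auto intro: order_trans[OF _ measure_nonneg])
    next
      case False
      have "emeasure unif01 S = (SUP K\<in>{K. K \<subseteq> S \<and> compact K}. emeasure unif01 K)"
        using S by (intro inner_regular) (auto simp: unif01.emeasure_eq_measure)
      moreover have "ennreal (measure unif01 S - e) < emeasure unif01 S"
        using False e by (simp add: unif01.emeasure_eq_measure ennreal_less_iff)
      ultimately obtain K where K: "K \<subseteq> S" "compact K" "ennreal (measure unif01 S - e) < emeasure unif01 K"
        by (auto simp: less_SUP_iff)
      then have "measure unif01 S - e < measure unif01 K"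
        using False by (simp add: unif01.emeasure_eq_measure ennreal_less_iff)
      \<comment> \<open>Adding a point keeps the compact set nonempty, which the compact version
        requires.\<close>
      also have "\<dots> \<le> measure unif01 (insert s K)"
        using K by (intro unif01.finite_measure_mono) (auto simp: borel_compact)
      finally show ?thesis
        using K s by (intro exI[of _ "insert s K"]) (auto intro: compact_insert)
    qed
  qed
  fix e :: real assume e: "0 < e"
  obtain K where K: "K \<subseteq> A" "compact K" "K \<noteq> {}" "measure unif01 A - e \<le> measure unif01 K"
    using inner[OF A(1,3) e] by blast
  obtain L where L: "L \<subseteq> B" "compact L" "L \<noteq> {}" "measure unif01 B - e \<le> measure unif01 L"
    using inner[OF B(1,3) e] by blast
  have "l * measure lborel K + (1 - l) * measure lborel L \<le> measure lborel C"
    using K L comb by (intro brunn_minkowski_compact_real C l) auto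
  then have "l * measure unif01 K + (1 - l) * measure unif01 L \<le> measure unif01 C"
    using subset_trans[OF K(1) A(2)] subset_trans[OF L(1) B(2)] K(2) L(2) C
    by (simp add: measure_unif01 borel_compact)
  moreover have "l * (measure unif01 A - e) \<le> l * measure unif01 K"
    "(1 - l) * (measure unif01 B - e) \<le> (1 - l) * measure unif01 L"
    using K L l by (auto intro!: mult_left_mono)
  ultimately show "l * measure unif01 A + (1 - l) * measure unif01 B \<le> measure unif01 C + e"
    by (simp add: algebra_simps)
qed

text \<open>Fubini for the region under the graph. The level \<open>t\<close> runs through the unit
  interval only, hence the truncation at 1.\<close>

lemma layer_cake_unif01:
  fixes f :: "real \<Rightarrow> real"
  assumes [measurable]: "f \<in> borel_measurable borel" and nonneg: "\<And>x. 0 \<le> f x"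
  shows "integrable unif01 (\<lambda>t. measure unif01 ({0..1} \<inter> {x. t < f x}))"
    and "(\<integral>t. measure unif01 ({0..1} \<inter> {x. t < f x}) \<partial>unif01) = (\<integral>x. min 1 (f x) \<partial>unif01)"
proof -
  interpret U: pair_sigma_finite unif01 unif01 by unfold_locales
  let ?D = "{p \<in> space (unif01 \<Otimes>\<^sub>M unif01). fst p \<in> {0..1} \<and> snd p < f (fst p)}"
  have D: "?D \<in> sets (unif01 \<Otimes>\<^sub>M unif01)" by measurable
  have sec: "(\<lambda>x. (x, t)) -` ?D = {0..1} \<inter> {x. t < f x}" for t
    by (auto simp: space_pair_measure)
  have m: "(\<lambda>t. measure unif01 ({0..1} \<inter> {x. t < f x})) \<in> borel_measurable unif01"
    using U.measurable_emeasure_Pair2[OF D] unfolding sec measure_def by simp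
  show int: "integrable unif01 (\<lambda>t. measure unif01 ({0..1} \<inter> {x. t < f x}))"
    by (rule unif01.integrable_const_bound[of _ 1]) (auto intro: m)
  have int2: "integrable unif01 (\<lambda>x. min 1 (f x))"
    by (rule unif01.integrable_const_bound[of _ 1]) (auto simp: nonneg)
  have sec2: "emeasure unif01 (Pair x -` ?D) = indicator {0..1} x * ennreal (min 1 (f x))" for x
  proof -
    have "Pair x -` ?D = (if x \<in> {0..1} then {..<f x} else {})"
      by (auto simp: space_pair_measure)
    moreover have "{0..1} \<inter> {..<f x} = (if f x \<le> 1 then {0..<f x} else {0..1})" by auto
    ultimately show ?thesis using nonneg[of x] by (auto simp: min_def emeasure_unif01)
  qed
  have "(\<integral>\<^sup>+t. ennreal (measure unif01 ({0..1} \<inter> {x. t < f x})) \<partial>unif01) = emeasure (unif01 \<Otimes>\<^sub>M unif01) ?D"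
    unfolding U.emeasure_pair_measure_alt2[OF D] sec
    by (simp add: unif01.emeasure_eq_measure)
  also have "\<dots> = (\<integral>\<^sup>+x. indicator {0..1} x * ennreal (min 1 (f x)) \<partial>unif01)"
    unfolding unif01.emeasure_pair_measure_alt[OF D] sec2 ..
  also have "\<dots> = (\<integral>\<^sup>+x. ennreal (min 1 (f x)) \<partial>unif01)"
    unfolding unif01_def by (intro nn_integral_cong_AE AE_uniform_measureI) auto
  finally have "ennreal (\<integral>t. measure unif01 ({0..1} \<inter> {x. t < f x}) \<partial>unif01) = ennreal (\<integral>x. min 1 (f x) \<partial>unif01)"
    using int int2 nonneg by (subst (asm) (1 2) nn_integral_eq_integral) auto
  then show "(\<integral>t. measure unif01 ({0..1} \<inter> {x. t < f x}) \<partial>unif01) = (\<integral>x. min 1 (f x) \<partial>unif01)"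
    using nonneg by (subst (asm) ennreal_inj) (auto intro!: integral_nonneg_AE)
qed

text \<open>The level 1 has to be excluded: a function scaled to supremum 1 has no points above it,
  and Brunn-Minkowski is false for empty sets.\<close>

lemma AE_unif01: "AE x in unif01. 0 \<le> x \<and> x < 1"
  unfolding unif01_def
proof (rule AE_uniform_measureI)
  show "AE x in lborel. x \<in> {0..1::real} \<longrightarrow> 0 \<le> x \<and> x < 1"
    using AE_lborel_singleton[of "1::real"] by (rule AE_mp) (auto intro!: AE_I2)
qed simp

lemma integrable_unif01:
  fixes f :: "real \<Rightarrow> real"
  assumes "f \<in> borel_measurable borel" "\<And>x. 0 \<le> f x" "\<And>x. f x \<le> B"
  shows "integrable unif01 f"
proof (rule unif01.integrable_const_bound[of _ B])
  show "AE x in unif01. norm (f x) \<le> B" using assms(2,3) by simp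
  show "f \<in> borel_measurable unif01" using assms(1) by (simp cong: measurable_cong_sets)
qed

lemma integral_unif01_cong:
  fixes f g :: "real \<Rightarrow> real"
  assumes "f \<in> borel_measurable borel" "g \<in> borel_measurable borel" "\<And>x. x \<in> {0..1} \<Longrightarrow> f x = g x"
  shows "(\<integral>x. f x \<partial>unif01) = (\<integral>x. g x \<partial>unif01)"
proof (rule integral_cong_AE)
  show "AE x in unif01. f x = g x"
    using AE_unif01 by (rule AE_mp) (auto intro!: AE_I2 assms(3))
qed (use assms in \<open>simp_all cong: measurable_cong_sets\<close>)

text \<open>Both functions are scaled to have supremum 1, so that all level sets \<open>{f > t}\<close>, \<open>{g > t}\<close> with
  \<open>t < 1\<close> are nonempty and the one-dimensional Brunn-Minkowski inequality applies level by level.\<close>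

lemma prekopa_leindler_unif01:
  fixes f g h :: "real \<Rightarrow> real"
  assumes [measurable]: "f \<in> borel_measurable borel" "g \<in> borel_measurable borel" "h \<in> borel_measurable borel"
    and f: "\<And>x. 0 \<le> f x" "\<And>x. f x \<le> 1" and g: "\<And>x. 0 \<le> g x" "\<And>x. g x \<le> 1"
    and h: "\<And>x. 0 \<le> h x" "\<And>x. h x \<le> 1" and l: "0 < l" "l < 1"
    and comb: "\<And>x y. f x powr l * g y powr (1 - l) \<le> h (l * x + (1 - l) * y)"
  shows "(\<integral>x. f x \<partial>unif01) powr l * (\<integral>x. g x \<partial>unif01) powr (1 - l) \<le> (\<integral>x. h x \<partial>unif01)"
proof -
  define I where "I = (\<lambda>f :: real \<Rightarrow> real. \<integral>x. f x \<partial>unif01)"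
  have I0: "0 \<le> I f" if "\<And>x. 0 \<le> f x" for f unfolding I_def using that by (intro integral_nonneg_AE) auto
  have intf: "integrable unif01 f" "integrable unif01 g" "integrable unif01 h"
    using f g h by (auto intro!: integrable_unif01)
  show ?thesis
  proof (cases "I f = 0 \<or> I g = 0")
    case True
    then show ?thesis using l I0[OF h(1)] by (auto simp: I_def)
  next
    case False
    define S where "S = (\<lambda>f :: real \<Rightarrow> real. SUP x\<in>{0..1}. f x)"
    have bdd: "bdd_above (f ` {0..1})" if "\<And>x. f x \<le> 1" for f :: "real \<Rightarrow> real"
      using that by (intro bdd_aboveI2)
    have le_S: "f x \<le> S f" if "\<And>x. f x \<le> 1" "x \<in> {0..1}" for f :: "real \<Rightarrow> real" and x
      unfolding S_def using that bdd[of f] by (intro cSUP_upper) auto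
    have S_pos: "0 < S f" if m: "f \<in> borel_measurable borel" and f: "\<And>x. 0 \<le> f x" "\<And>x. f x \<le> 1" "I f \<noteq> 0" for f
    proof (rule ccontr)
      assume "\<not> 0 < S f"
      then have "f x = 0" if "x \<in> {0..1}" for x using le_S[of f x, OF f(2) that] f(1)[of x] by simp
      then have "I f = I (\<lambda>_. 0)"
        unfolding I_def by (intro integral_unif01_cong m) auto
      then show False using f(3) by (simp add: I_def)
    qed
    have ex: "\<exists>x\<in>{0..1}. t < f x / S f" if f: "\<And>x. f x \<le> 1" "0 < S f" and t: "t < 1" for f t
    proof -
      have "t * S f < S f" using f t by simp
      then obtain x where "x \<in> {0..1}" "t * S f < f x"
        using less_cSUP_iff[of "{0..1}" f "t * S f"] bdd[of f, OF f(1)] by (auto simp: S_def)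
      then show ?thesis using f(2) by (auto simp: pos_less_divide_eq)
    qed
    have F: "0 < S f" by (rule S_pos) (use False f in auto)
    have G: "0 < S g" by (rule S_pos) (use False g in auto)
    \<comment> \<open>The scale for \<open>h\<close> that matches: \<open>f x > t * S f\<close> and
      \<open>g y > t * S g\<close> imply \<open>h > t * K\<close> at the combined point.\<close>
    define K where "K = S f powr l * S g powr (1 - l)"
    have K: "0 < K" using F G by (simp add: K_def)
    define lev where "lev = (\<lambda>(f :: real \<Rightarrow> real) t. measure unif01 ({0..1} \<inter> {x. t < f x}))"
    have "l * I (lev (\<lambda>x. f x / S f)) + (1 - l) * I (lev (\<lambda>x. g x / S g)) \<le> I (lev (\<lambda>x. h x / K))"
    proof -
      have int: "integrable unif01 (lev (\<lambda>x. f x / S f))" "integrable unif01 (lev (\<lambda>x. g x / S g))"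
        "integrable unif01 (lev (\<lambda>x. h x / K))"
        unfolding lev_def by (rule layer_cake_unif01(1); use f g h F G K in simp)+
      have "I (\<lambda>t. l * lev (\<lambda>x. f x / S f) t + (1 - l) * lev (\<lambda>x. g x / S g) t) \<le> I (lev (\<lambda>x. h x / K))"
        unfolding I_def
      proof (rule integral_mono_AE)
        show "AE t in unif01. l * lev (\<lambda>x. f x / S f) t + (1 - l) * lev (\<lambda>x. g x / S g) t \<le> lev (\<lambda>x. h x / K) t"
          using AE_unif01
        proof (rule AE_mp, intro AE_I2 impI)
          fix t :: real assume t: "0 \<le> t \<and> t < 1"
          show "l * lev (\<lambda>x. f x / S f) t + (1 - l) * lev (\<lambda>x. g x / S g) t \<le> lev (\<lambda>x. h x / K) t"
            unfolding lev_def
          proof (rule brunn_minkowski_real[OF _ _ _ _ _ _ _ _ l])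
            show "{0..1} \<inter> {x. t < f x / S f} \<noteq> {}" "{0..1} \<inter> {x. t < g x / S g} \<noteq> {}"
              using ex[OF f(2) F, of t] ex[OF g(2) G, of t] t by auto
            fix x y assume x: "x \<in> {0..1} \<inter> {x. t < f x / S f}" and y: "y \<in> {0..1} \<inter> {x. t < g x / S g}"
            have "t * S f < f x" "t * S g < g y" using x y F G by (auto simp: pos_less_divide_eq)
            then have "(t * S f) powr l * (t * S g) powr (1 - l) < f x powr l * g y powr (1 - l)"
              using l t F G by (intro mult_strict_mono' powr_less_mono2) auto
            moreover have "(t * S f) powr l * (t * S g) powr (1 - l) = t powr l * t powr (1 - l) * K"
              using t F G by (simp add: K_def powr_mult)
            moreover have "t powr l * t powr (1 - l) = t" using t by (simp add: powr_add[symmetric])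
            ultimately have "t * K < h (l * x + (1 - l) * y)" using comb[of x y] by simp
            then have "t < h (l * x + (1 - l) * y) / K" using K by (simp add: pos_less_divide_eq)
            moreover have "l * x + (1 - l) * y \<in> {0..1}"
              using convexD[of "{0..1::real}" x y l "1 - l"] x y l by (simp add: convex_real_interval)
            ultimately show "l * x + (1 - l) * y \<in> {0..1} \<inter> {x. t < h x / K}" by simp
          qed auto
        qed
      qed (use int in auto)
      then show ?thesis using int by (simp add: I_def)
    qed
    moreover have scaled: "I (lev (\<lambda>x. f x / S f)) = I f / S f"
      if [measurable]: "f \<in> borel_measurable borel" and f: "\<And>x. 0 \<le> f x" "\<And>x. f x \<le> 1" "0 < S f" for f
    proof -
      have "I (lev (\<lambda>x. f x / S f)) = I (\<lambda>x. min 1 (f x / S f))"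
        unfolding I_def lev_def by (rule layer_cake_unif01(2)) (use f in auto)
      also have "\<dots> = I (\<lambda>x. f x / S f)"
        unfolding I_def using f le_S[of f]
        by (intro integral_unif01_cong) (auto simp: min_def divide_le_eq intro!: antisym)
      also have "\<dots> = I f / S f" by (simp add: I_def)
      finally show ?thesis .
    qed
    \<comment> \<open>The function \<open>h / K\<close> may exceed 1, so truncation loses mass here;
      the inequality goes in the required direction.\<close>
    moreover have "I (lev (\<lambda>x. h x / K)) \<le> I h / K"
    proof -
      have "I (lev (\<lambda>x. h x / K)) = I (\<lambda>x. min 1 (h x / K))"
        unfolding I_def lev_def by (rule layer_cake_unif01(2)) (use h K in auto)
      also have "\<dots> \<le> I (\<lambda>x. h x / K)"
        unfolding I_def
      proof (rule integral_mono)
        show "integrable unif01 (\<lambda>x. min 1 (h x / K))" by (rule integrable_unif01[where B = 1]) (use h K in auto)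
        show "integrable unif01 (\<lambda>x. h x / K)" using intf(3) by simp
      qed simp
      finally show ?thesis by (simp add: I_def)
    qed
    ultimately have "l * (I f / S f) + (1 - l) * (I g / S g) \<le> I h / K"
      using scaled[of f] scaled[of g] f g F G by simp
    \<comment> \<open>Weighted arithmetic-geometric mean inequality; the powers of the suprema then
      combine to \<open>K\<close> and cancel.\<close>
    moreover have "(I f / S f) powr l * (I g / S g) powr (1 - l) \<le> l * (I f / S f) + (1 - l) * (I g / S g)"
      using False I0[of f] I0[of g] f g F G l by (intro Youngs_inequality_0) (auto simp: less_le)
    moreover have "(I f / S f) powr l * (I g / S g) powr (1 - l) = I f powr l * I g powr (1 - l) / K"
      using I0[of f] I0[of g] f g F G by (simp add: K_def powr_divide)
    ultimately have "I f powr l * I g powr (1 - l) / K \<le> I h / K" by simp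
    then show ?thesis using K by (simp add: I_def divide_le_cancel)
  qed
qed

section \<open>Log-concavity of the uniform measure by induction on the dimension\<close>

abbreviation unif_cube :: "nat \<Rightarrow> (nat \<Rightarrow> real) measure" where
  "unif_cube n \<equiv> Pi\<^sub>M {..<n} (\<lambda>_. unif01)"

lemma prob_space_unif_cube: "prob_space (unif_cube n)"
  by (intro prob_space_PiM unif01.prob_space_axioms)

lemma sets_unif_cube: "sets (unif_cube n) = sets (Pi\<^sub>M {..<n} (\<lambda>_. borel))"
  by (intro sets_PiM_cong) auto

lemma unif_cube_section:
  fixes n :: nat
  defines "sec \<equiv> \<lambda>A r. {x \<in> space (unif_cube n). x(n := r) \<in> A}"
  assumes A: "A \<in> sets (unif_cube (Suc n))"
  shows "sec A r \<in> sets (unif_cube n)"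
    and "(\<lambda>r. measure (unif_cube n) (sec A r)) \<in> borel_measurable borel"
    and "measure (unif_cube (Suc n)) A = (\<integral>r. measure (unif_cube n) (sec A r) \<partial>unif01)"
proof -
  interpret C: prob_space "unif_cube n" by (rule prob_space_unif_cube)
  interpret D: prob_space "unif_cube (Suc n)" by (rule prob_space_unif_cube)
  interpret P: product_sigma_finite "\<lambda>_::nat. unif01" by unfold_locales
  interpret Q: pair_sigma_finite "unif_cube n" unif01 by unfold_locales
  have Suc: "{..<Suc n} = insert n {..<n}" by auto
  have upd: "(\<lambda>(x, r). x(n := r)) \<in> measurable (unif_cube n \<Otimes>\<^sub>M unif01) (unif_cube (Suc n))"
    unfolding Suc by (rule measurable_add_dim)
  let ?A = "(\<lambda>(x, r). x(n := r)) -` A \<inter> space (unif_cube n \<Otimes>\<^sub>M unif01)"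
  have A': "?A \<in> sets (unif_cube n \<Otimes>\<^sub>M unif01)" by (rule measurable_sets[OF upd A])
  have sec: "(\<lambda>x. (x, r)) -` ?A = sec A r" for r
    by (auto simp: sec_def space_pair_measure)
  show s: "sec A r \<in> sets (unif_cube n)" for r
    using sets_Pair2[OF A', of r] unfolding sec .
  show m: "(\<lambda>r. measure (unif_cube n) (sec A r)) \<in> borel_measurable borel"
    using Q.measurable_emeasure_Pair2[OF A'] unfolding sec measure_def by (simp cong: measurable_cong_sets)
  have "emeasure (unif_cube (Suc n)) A = (\<integral>\<^sup>+y. indicator A y \<partial>unif_cube (Suc n))"
    using A by simp
  also have "\<dots> = (\<integral>\<^sup>+r. (\<integral>\<^sup>+x. indicator A (x(n := r)) \<partial>unif_cube n) \<partial>unif01)"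
    unfolding Suc using A by (intro P.product_nn_integral_insert_rev) (auto simp: Suc)
  also have "\<dots> = (\<integral>\<^sup>+r. ennreal (measure (unif_cube n) (sec A r)) \<partial>unif01)"
  proof (intro nn_integral_cong)
    fix r
    have "(\<integral>\<^sup>+x. indicator A (x(n := r)) \<partial>unif_cube n) = (\<integral>\<^sup>+x. indicator (sec A r) x \<partial>unif_cube n)"
      by (intro nn_integral_cong) (auto simp: sec_def split: split_indicator)
    then show "(\<integral>\<^sup>+x. indicator A (x(n := r)) \<partial>unif_cube n) = ennreal (measure (unif_cube n) (sec A r))"
      using s by (simp add: C.emeasure_eq_measure)
  qed
  also have "\<dots> = ennreal (\<integral>r. measure (unif_cube n) (sec A r) \<partial>unif01)"
    using m by (intro nn_integral_eq_integral integrable_unif01[where B = 1]) auto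
  finally show "measure (unif_cube (Suc n)) A = (\<integral>r. measure (unif_cube n) (sec A r) \<partial>unif01)"
    unfolding D.emeasure_eq_measure by (subst (asm) ennreal_inj) (auto intro!: integral_nonneg_AE)
qed

text \<open>Sections of \<open>A\<close>, \<open>B\<close>, \<open>C\<close> along the last
  coordinate satisfy the hypothesis one dimension lower. The induction hypothesis then gives for the
  section masses exactly the premise of Prekopa-Leindler, and Fubini identifies the
  integrals.\<close>

lemma log_concave_space_unif_cube: "log_concave_space (unif_cube n) n"
proof (induction n)
  case 0
  interpret prob_space "unif_cube 0" by (rule prob_space_unif_cube)
  show ?case
  proof (unfold_locales, rule sets_unif_cube)
    fix A B C and l :: real
    assume A: "A \<in> events" and B: "B \<in> events" and C: "C \<in> events" and l: "0 < l" "l < 1"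
      and comb: "\<And>x y. x \<in> A \<Longrightarrow> y \<in> B \<Longrightarrow> Rn_lincomb 0 l x (1 - l) y \<in> C"
    show "prob A powr l * prob B powr (1 - l) \<le> prob C"
    proof (cases "A = {} \<or> B = {}")
      case True then show ?thesis using l by auto
    next
      case False
      then have "(\<lambda>_. undefined) \<in> C"
        using comb by (auto simp: Rn_lincomb_def restrict_def)
      then have "C = space (unif_cube 0)"
        using sets.sets_into_space[OF C] by (auto simp: space_PiM)
      then have "prob C = 1" using prob_space by (simp only:)
      moreover have "prob A powr l * prob B powr (1 - l) \<le> 1"
        by (intro mult_le_one powr_le1 prob_le_1) (use l in \<open>simp_all del: lessThan_0\<close>)
      ultimately show ?thesis by simp
    qed
  qed
next
  case (Suc n)
  interpret C: log_concave_space "unif_cube n" n by (rule Suc.IH)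
  interpret D: prob_space "unif_cube (Suc n)" by (rule prob_space_unif_cube)
  show ?case
  proof (unfold_locales, rule sets_unif_cube)
    fix A B C and l :: real
    assume A: "A \<in> D.events" and B: "B \<in> D.events" and C: "C \<in> D.events" and l: "0 < l" "l < 1"
      and comb: "\<And>x y. x \<in> A \<Longrightarrow> y \<in> B \<Longrightarrow> Rn_lincomb (Suc n) l x (1 - l) y \<in> C"
    let ?s = "\<lambda>A r. {x \<in> space (unif_cube n). x(n := r) \<in> A}"
    have "C.prob (?s A r) powr l * C.prob (?s B t) powr (1 - l) \<le> C.prob (?s C (l * r + (1 - l) * t))" for r t
    proof (rule C.log_concave[OF unif_cube_section(1)[OF A] unif_cube_section(1)[OF B] unif_cube_section(1)[OF C] l])
      fix x y assume x: "x \<in> ?s A r" and y: "y \<in> ?s B t"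
      have "Rn_lincomb (Suc n) l (x(n := r)) (1 - l) (y(n := t)) = (Rn_lincomb n l x (1 - l) y)(n := l * r + (1 - l) * t)"
        by (auto simp: Rn_lincomb_def fun_eq_iff restrict_def)
      then show "Rn_lincomb n l x (1 - l) y \<in> ?s C (l * r + (1 - l) * t)"
        using comb[of "x(n := r)" "y(n := t)"] x y by (simp add: C.space_M Rn_lincomb_in_Rn)
    qed
    then show "D.prob A powr l * D.prob B powr (1 - l) \<le> D.prob C"
      unfolding unif_cube_section(3)[OF A] unif_cube_section(3)[OF B] unif_cube_section(3)[OF C]
      by (intro prekopa_leindler_unif01 unif_cube_section(2)[OF A] unif_cube_section(2)[OF B] unif_cube_section(2)[OF C] l) auto
  qed
qed

text \<open>The hyperplane is in fact a null set: integrate first over a coordinate \<open>k\<close>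
  with \<open>a k \<noteq> 0\<close>, where at most one value is allowed.\<close>

lemma unif_cube_hyperplane:
  assumes "Rn_hyperplane n H"
  shows "measure (unif_cube n) H < 1"
proof -
  obtain a b k where k: "k < n" "a k \<noteq> 0" and H: "H = {x \<in> Rn n. (\<Sum>i<n. a i * x i) = b}"
    using assms unfolding Rn_hyperplane_def by blast
  interpret P: product_sigma_finite "\<lambda>_::nat. unif01" by unfold_locales
  interpret C: log_concave_space "unif_cube n" n by (rule log_concave_space_unif_cube)
  let ?I = "{..<n} - {k}"
  have ins: "{..<n} = insert k ?I" using k by auto
  have "H = {x \<in> space (unif_cube n). (\<Sum>i<n. a i * x i) = b}" unfolding H by (simp add: C.space_M)
  also have "\<dots> \<in> C.events"
    by (intro borel_measurable_eq borel_measurable_sum borel_measurable_times borel_measurable_const C.measurable_coordinate) auto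
  finally have sH: "H \<in> C.events" .
  have "(\<integral>\<^sup>+y. indicator H (x(k := y)) \<partial>unif01) = 0" for x
  proof -
    define c where "c = (b - (\<Sum>i\<in>?I. a i * x i)) / a k"
    have "y = c" if "x(k := y) \<in> H" for y
    proof -
      have "(\<Sum>i<n. a i * (x(k := y)) i) = a k * y + (\<Sum>i\<in>?I. a i * x i)"
        by (subst ins, subst sum.insert) auto
      then show ?thesis using that k by (simp add: H c_def field_simps)
    qed
    then have "indicator H (x(k := y)) \<le> (indicator {c} y :: ennreal)" for y
      by (cases "x(k := y) \<in> H") auto
    then have "(\<integral>\<^sup>+y. indicator H (x(k := y)) \<partial>unif01) \<le> (\<integral>\<^sup>+y. indicator {c} y \<partial>unif01)"
      by (rule nn_integral_mono)
    also have "\<dots> = emeasure unif01 {c}" by simp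
    also have "\<dots> \<le> emeasure lborel {c}"
      unfolding emeasure_unif01[OF borel_closed[OF closed_singleton]] by (intro emeasure_mono) auto
    finally show ?thesis by simp
  qed
  moreover have "emeasure (unif_cube n) H = (\<integral>\<^sup>+x. (\<integral>\<^sup>+y. indicator H (x(k := y)) \<partial>unif01) \<partial>Pi\<^sub>M ?I (\<lambda>_. unif01))"
  proof -
    have "indicator H \<in> borel_measurable (Pi\<^sub>M (insert k ?I) (\<lambda>_. unif01))"
      unfolding ins[symmetric] using sH by simp
    then have "(\<integral>\<^sup>+x. indicator H x \<partial>Pi\<^sub>M (insert k ?I) (\<lambda>_. unif01)) =
        (\<integral>\<^sup>+x. (\<integral>\<^sup>+y. indicator H (x(k := y)) \<partial>unif01) \<partial>Pi\<^sub>M ?I (\<lambda>_. unif01))"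
      by (intro P.product_nn_integral_insert) auto
    moreover have "emeasure (unif_cube n) H = (\<integral>\<^sup>+x. indicator H x \<partial>unif_cube n)" using sH by simp
    ultimately show ?thesis unfolding ins[symmetric] by simp
  qed
  ultimately show ?thesis by (simp add: measure_def)
qed

lemma compactin_Rn_lincomb:
  assumes "compactin (Rn_topology n) A" "compactin (Rn_topology n) B"
  shows "compactin (Rn_topology n) {Rn_lincomb n u x v y |x y. x \<in> A \<and> y \<in> B}"
proof -
  let ?T = "Rn_topology n"
  have "continuous_map (prod_topology ?T ?T) ?T (\<lambda>p. Rn_lincomb n u (fst p) v (snd p))"
  proof -
    have proj: "continuous_map ?T euclideanreal (\<lambda>x. x i)" if "i < n" for i
      unfolding Rn_topology_def using that by (intro continuous_map_product_projection) auto
    have "continuous_map (prod_topology ?T ?T) euclideanreal (\<lambda>p. u * fst p i + v * snd p i)" if "i < n" for i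
      using continuous_map_compose[OF continuous_map_fst proj[OF that], of ?T]
        continuous_map_compose[OF continuous_map_snd proj[OF that], of ?T]
      by (intro continuous_map_add continuous_map_real_mult_left) (auto simp: o_def)
    then show ?thesis
      unfolding Rn_topology_def[of n]
      by (subst continuous_map_componentwise) (auto simp: Rn_lincomb_def Rn_topology_def)
  qed
  moreover have "compactin (prod_topology ?T ?T) (A \<times> B)"
    using assms by (simp add: compactin_Times)
  ultimately have "compactin ?T ((\<lambda>p. Rn_lincomb n u (fst p) v (snd p)) ` (A \<times> B))"
    by (rule image_compactin[rotated])
  moreover have "(\<lambda>p. Rn_lincomb n u (fst p) v (snd p)) ` (A \<times> B) = {Rn_lincomb n u x v y |x y. x \<in> A \<and> y \<in> B}"
    by force
  ultimately show ?thesis by simp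
qed

lemma sets_Rn_borel_compactin:
  assumes "compactin (Rn_topology n) S"
  shows "S \<in> sets (Rn_borel n)"
proof -
  have "Hausdorff_space (Rn_topology n)"
    unfolding Rn_topology_def by (simp add: Hausdorff_space_product_topology Hausdorff_space_euclidean)
  then have "closedin (Rn_topology n) S" using assms by (rule compactin_imp_closedin)
  then have "openin (Rn_topology n) (Rn n - S)" and sub: "S \<subseteq> Rn n"
    by (auto simp: closedin_def topspace_Rn_topology)
  moreover have "{U. openin (Rn_topology n) U} \<subseteq> Pow (Rn n)"
    using openin_subset[of "Rn_topology n"] unfolding topspace_Rn_topology by blast
  ultimately have "Rn n - S \<in> sets (Rn_borel n)"
    by (auto simp: Rn_borel_def sets_measure_of intro: sigma_sets.Basic)
  then have "space (Rn_borel n) - (Rn n - S) \<in> sets (Rn_borel n)" by (rule sets.compl_sets)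
  moreover have "space (Rn_borel n) - (Rn n - S) = S" using sub by (auto simp: space_Rn_borel)
  ultimately show ?thesis by simp
qed

lemma log_concave_prob_unif_cube: "log_concave_prob n (unif_cube n)"
proof -
  interpret log_concave_space "unif_cube n" n by (rule log_concave_space_unif_cube)
  have sets: "sets (unif_cube n) = sets (Rn_borel n)" by (simp add: sets_M sets_Rn_borel)
  have "prob A powr l * prob B powr (1 - l) \<le> prob {Rn_lincomb n l x (1 - l) y |x y. x \<in> A \<and> y \<in> B}"
    if AB: "compactin (Rn_topology n) A" "compactin (Rn_topology n) B" and l: "0 < l" "l < 1" for A B l
    using AB compactin_Rn_lincomb[OF AB, of l "1 - l"]
    by (intro log_concave[OF _ _ _ l]) (auto simp: sets sets_Rn_borel_compactin)
  then show ?thesis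
    unfolding log_concave_prob_def using prob_space_axioms sets unif_cube_hyperplane by blast
qed

section \<open>The threshold\<close>

text \<open>For \<open>n \<ge> 400\<close> the constant 400 costs one factor \<open>n\<close> per
  dimension, and the remaining factor \<open>n\<close> is absorbed in \<open>n^n\<close>: the
  exponent is \<open>6 n + n\<close>.\<close>

lemma cube_mass_ge:
  assumes n: "n \<ge> 400"
  shows "1 / real n ^ (7 * n) \<le> cube_mass n"
proof -
  have "400 * real n ^ 5 \<le> real n * real n ^ 5" using n by (intro mult_right_mono) auto
  then have "400 * real n ^ 5 \<le> real n ^ 6" by (simp add: power_eq_if)
  then have "(400 * real n ^ 5) ^ n * real n \<le> (real n ^ 6) ^ n * real n ^ n"
    using n self_le_power[of "real n" n] by (intro mult_mono power_mono) auto
  also have "\<dots> = real n ^ (7 * n)" by (simp add: power_mult[symmetric] power_add[symmetric])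
  finally show ?thesis
    unfolding cube_mass_def using n by (intro divide_left_mono) auto
qed

text \<open>The product \<delta> N is at least \<open>n^(10 n - 7 n)\<close>, hence at least
  \<open>n^2\<close>, and \<open>(1 - \<delta>)^N\<close> is at most
  \<open>exp (- \<delta> N)\<close>, hence at most \<open>1/n^2\<close>.\<close>

lemma miss_le:
  assumes n: "n \<ge> 400" and N: "exp (10 * real n * ln (real n)) \<le> real N"
  shows "2 * real n * (1 - cube_mass n) ^ N \<le> 2 / real n"
proof -
  define \<delta> where "\<delta> = cube_mass n"
  have \<delta>: "1 / real n ^ (7 * n) \<le> \<delta>" unfolding \<delta>_def by (rule cube_mass_ge[OF n])
  have "exp (10 * real n * ln (real n)) = real n powr real (10 * n)"
    using n by (simp add: powr_def)
  also have "\<dots> = real n ^ (10 * n)" using n by (intro powr_realpow) auto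
  finally have N': "real n ^ (10 * n) \<le> real N" using N by simp
  have "(real n)\<^sup>2 \<le> real n ^ (3 * n)" using n by (intro power_increasing) auto
  also have "\<dots> = 1 / real n ^ (7 * n) * real n ^ (10 * n)"
    using n power_add[of "real n" "7 * n" "3 * n"] by simp
  also have "\<dots> \<le> \<delta> * real N"
    using \<delta> N' n by (intro mult_mono) (auto intro: order_trans[OF _ \<delta>])
  finally have big: "(real n)\<^sup>2 \<le> \<delta> * real N" .
  have d1: "\<delta> \<le> 1" using cube_mass_le_1[of n] n by (simp add: \<delta>_def)
  have "(1 - \<delta>) ^ N \<le> exp (- \<delta>) ^ N"
    using exp_ge_add_one_self[of "- \<delta>"] d1 by (intro power_mono) auto
  also have "\<dots> = 1 / exp (\<delta> * real N)"
    by (simp add: exp_minus exp_of_nat_mult[symmetric] mult.commute power_inverse divide_inverse)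
  also have "\<dots> \<le> 1 / (real n)\<^sup>2"
  proof (intro divide_left_mono)
    show "(real n)\<^sup>2 \<le> exp (\<delta> * real N)"
      using big exp_ge_add_one_self[of "\<delta> * real N"] by linarith
  qed (use n in auto)
  finally have "2 * real n * (1 - \<delta>) ^ N \<le> 2 * real n * (1 / (real n)\<^sup>2)"
    by (intro mult_left_mono) auto
  then show ?thesis using n by (simp add: \<delta>_def power2_eq_square)
qed

lemma expected_polytope_measure_bound:
  assumes lc: "log_concave_prob n M" and n: "n \<ge> 5001" and N: "n < N" "exp (10 * real n * ln (real n)) \<le> real N"
  shows "(1 - 2 / real n)\<^sup>2 * real n powr (- 7 / real n) \<le> expected_polytope_measure n N M"
proof -
  have miss: "2 * real n * (1 - cube_mass n) ^ N \<le> 2 / real n"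
    using n N by (intro miss_le) auto
  also have "\<dots> < 1" using n by simp
  finally have lt1: "2 * real n * (1 - cube_mass n) ^ N < 1" .
  then have main: "(1 - 2 * real n * (1 - cube_mass n) ^ N) * ((1 - 2 / real n) * cube_mass n powr (1 / (real n)\<^sup>2))
      \<le> expected_polytope_measure n N M"
    using expected_polytope_measure_lower(1)[OF lc n, of N] N lt1 by auto
  have "real n powr (- 7 / real n) = (1 / real n ^ (7 * n)) powr (1 / (real n)\<^sup>2)"
  proof -
    have "1 / real n ^ (7 * n) = real n powr (- real (7 * n))"
      using n by (simp add: powr_minus_divide powr_realpow[symmetric])
    moreover have "- real (7 * n) * (1 / (real n)\<^sup>2) = - 7 / real n"
      using n by (simp add: power2_eq_square)
    ultimately show ?thesis by (simp only: powr_powr)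
  qed
  also have "\<dots> \<le> cube_mass n powr (1 / (real n)\<^sup>2)"
    using cube_mass_ge[of n] n by (intro powr_mono2) auto
  finally have "(1 - 2 / real n) * ((1 - 2 / real n) * real n powr (- 7 / real n)) \<le>
      (1 - 2 * real n * (1 - cube_mass n) ^ N) * ((1 - 2 / real n) * cube_mass n powr (1 / (real n)\<^sup>2))"
    using miss lt1 n by (intro mult_mono) auto
  then show ?thesis using main by (simp add: power2_eq_square mult.assoc)
qed

theorem theorem1p3:
  shows "\<exists>C::real. C > 0 \<and>
           (\<lambda>n. INF \<mu>\<in>{\<mu>. log_concave_prob n \<mu>}.
              INF N\<in>{N. n < N \<and> exp (C * real n * ln (real n)) \<le> real N}.
                expected_polytope_measure n N \<mu>) \<longlonglongrightarrow> 1"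
proof (intro exI[of _ 10] conjI)
  define A where "A = (\<lambda>n. {N. n < N \<and> exp (10 * real n * ln (real n)) \<le> real N})"
  define f where "f = (\<lambda>n. INF \<mu>\<in>{\<mu>. log_concave_prob n \<mu>}. INF N\<in>A n. expected_polytope_measure n N \<mu>)"
  define g where "g = (\<lambda>n. (1 - 2 / real n)\<^sup>2 * real n powr (- 7 / real n))"
  \<comment> \<open>The inner infimum is also one of reals and needs a nonempty index set.\<close>
  have A: "A n \<noteq> {}" for n
  proof -
    have "max (Suc n) (nat \<lceil>exp (10 * real n * ln (real n))\<rceil>) \<in> A n"
      unfolding A_def by (auto simp: of_nat_max) linarith
    then show ?thesis by blast
  qed
  have lower: "g n \<le> f n" and upper: "f n \<le> 1" if n: "n \<ge> 5001" for n
  proof -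
    have g0: "0 \<le> g n" by (simp add: g_def)
    have bound: "g n \<le> expected_polytope_measure n N \<mu>" if "log_concave_prob n \<mu>" "N \<in> A n" for \<mu> N
      using expected_polytope_measure_bound[OF that(1) n] that(2) by (simp add: g_def A_def)
    have inner: "g n \<le> (INF N\<in>A n. expected_polytope_measure n N \<mu>)" if "log_concave_prob n \<mu>" for \<mu>
      by (rule cINF_greatest) (use bound[OF that] A in auto)
    define \<mu> where "\<mu> = unif_cube n"
    have \<mu>: "log_concave_prob n \<mu>" unfolding \<mu>_def by (rule log_concave_prob_unif_cube)
    show "g n \<le> f n" unfolding f_def by (rule cINF_greatest) (use \<mu> inner in auto)
    obtain N where N: "N \<in> A n" using A by blast
    \<comment> \<open>The upper bound requires both infima to be bounded below; \<open>g n\<close>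
      serves as the bound.\<close>
    have "f n \<le> (INF N\<in>A n. expected_polytope_measure n N \<mu>)"
      unfolding f_def using \<mu> inner by (intro cINF_lower bdd_belowI2[where m = "g n"]) auto
    also have "\<dots> \<le> expected_polytope_measure n N \<mu>"
      using N bound[OF \<mu>] by (intro cINF_lower bdd_belowI2[where m = "g n"]) auto
    also have "\<dots> \<le> 1"
      using N by (intro expected_polytope_measure_lower(2)[OF \<mu> n]) (simp add: A_def)
    finally show "f n \<le> 1" .
  qed
  have "g \<longlonglongrightarrow> 1" unfolding g_def by real_asymp
  moreover have "\<forall>\<^sub>F n in sequentially. g n \<le> f n" "\<forall>\<^sub>F n in sequentially. f n \<le> 1"
    unfolding eventually_sequentially using lower upper by blast+
  ultimately have "f \<longlonglongrightarrow> 1"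
    by (intro tendsto_sandwich[of g f sequentially "\<lambda>_. 1"]) auto
  then show "(\<lambda>n. INF \<mu>\<in>{\<mu>. log_concave_prob n \<mu>}.
              INF N\<in>{N. n < N \<and> exp (10 * real n * ln (real n)) \<le> real N}.
                expected_polytope_measure n N \<mu>) \<longlonglongrightarrow> 1"
    by (simp add: f_def A_def)
qed simp

end
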